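(* Let $t\ge3$ be a prime and $q\ge t$. Let coordinates in $\mathrm{PG}(t-1,q^t)$ be such that $\Sigma=\{\langle(\lambda,\lambda^\sigma,\ldots,\lambda^{\sigma^{t-1}})\rangle_{q^t}:\lambda\in\mathbb{F}_{q^t}^*\}$ with $\sigma:x\mapsto x^{q^\nu}$, $\gcd(\nu,t)=1$, $\Gamma$ is the $(t-3)$-subspace $X_{t-1}=X_t=0$, and $\ell_0$ is the line $X_1=\cdots=X_{t-2}=0$ with coordinates $(x_{t-1},x_t)$, so that $\mathbb{L}=p_{\Gamma,\ell_0}(\Sigma)=\{\langle(\mu,\mu^\sigma)\rangle_{q^t}:\mu\in\mathbb{F}_{q^t}^*\}$. For any $h\in\{1,\ldots,t-1\}$ and any line $f$ of $\mathrm{PG}(2t-1,q)$ contained in an element of $\mathcal{S}_h$, the $q$-order subline $r=\mathcal{B}(f)$ is the projection under $p_{\Gamma,\ell_0}$ of a normal rational curve contained in $\Sigma$ of order $n$, where $1\le n\le t-1$ and $n\equiv h\nu^{-1}\pmod t$. In particular, if $q>t$, the normal rational curves $\Sigma\cap p^{-1}_{\Gamma,\ell_0}(\mathcal{B}(f))$ for lines $f$ contained in elements of $\mathcal{S}_{t-\nu}$ are exactly the sets $\mathcal{C}\cap\Sigma$ where $\mathcal{C}$ is a normal rational curve of order $t-1$ in $\mathrm{PG}(t-1,q^t)$ containing two points of $\Sigma$ and the points $P_\Gamma^{\hat\sigma^i}$, $i=0,\ldots,t-1$, where $\hat\sigma:\langle(x_1,\ldots,x_t)\rangle\mapsto\langle(x_t^\sigma,x_1^\sigma,\ldots,x_{t-1}^\sigma)\rangle$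 and $P_\Gamma=\langle(1,0,\ldots,0)\rangle$.
   Context: $\Sigma$ as given is a $q$-order canonical subgeometry (isomorphic to $\mathrm{PG}(t-1,q)$; its normal rational curves of order $n$ lie in $n$-subspaces and are projective images of $\{\langle(1,\lambda,\ldots,\lambda^n)\rangle:\lambda\in\mathbb{F}_q\}\cup\{\langle(0,\ldots,0,1)\rangle\}$). $p_{\Gamma,\ell_0}(X)=\{\langle\Gamma,P\rangle\cap\ell_0:P\in X\}$. A normal rational curve of order $t-1$ in $\mathrm{PG}(t-1,q^t)$ is a $\mathrm{PGL}(t,q^t)$-image of $\{\langle(1,y,\ldots,y^{t-1})\rangle:y\in\mathbb{F}_{q^t}\}\cup\{\langle(0,\ldots,0,1)\rangle\}$. $\mathrm{PG}(2t-1,q)=\mathrm{PG}_q(\mathbb{F}_{q^t}^2)$; the field reduction maps $X=\langle(a,b)\rangle_{q^t}\in\ell_0$ to $\mathcal{F}(X)=\{\langle(za,zb)\rangle_q:z\in\mathbb{F}_{q^t}^*\}$; for a subspace $f$ of $\mathrm{PG}(2t-1,q)$, $\mathcal{B}(f)=\{X:\mathcal{F}(X)\cap f\neq\emptyset\}$. $N(k)=k^{(q^t-1)/(q-1)}$; $S_{h,k}=\{\langle(z,kz^{q^h})\rangle_q:z\in\mathbb{F}_{q^t}^*\}$ and $\mathcal{S}_h=\{S_{h,k}:k\in\mathbb{F}_{q^t},N(k)=1\}$. A $q$-order subline of $\ell_0$ is a set projectively equivalent to $\{\langle(a,b)\rangle:(a,b)\in\mathbb{F}_q^2\setminus\{0\}\}$.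 *)

theory Defs
  imports
    "HOL-Number_Theory.Modular_Inverse"
    "HOL-Number_Theory.Prime_Powers"
    "Jordan_Normal_Form.Matrix"
begin

text \<open>
  The type \<open>'a\<close> plays the role of the field with \<open>q ^ t\<close> elements. Coordinate vectors are
  indexed from \<open>0\<close>, so that the coordinates \<open>X_1, ..., X_t\<close> are the entries
  \<open>0, ..., t - 1\<close>.
\<close>

text \<open>If \<open>'a\<close> has \<open>q ^ t\<close> elements, this is its unique subfield of order \<open>q\<close>.\<close>

definition Fq :: "nat \<Rightarrow> 'a::field set" where
  "Fq q = {x. x ^ q = x}"

definition frob :: "nat \<Rightarrow> nat \<Rightarrow> 'a::field \<Rightarrow> 'a" where
  "frob q \<nu> x = x ^ (q ^ \<nu>)"

definition field_norm :: "nat \<Rightarrow> nat \<Rightarrow> 'a::field \<Rightarrow> 'a" where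
  "field_norm q t k = k ^ ((q ^ t - 1) div (q - 1))"


subsection \<open>Projective spaces over the big field\<close>

text \<open>Projective subspaces are represented by the linear subspaces underlying them; in particular
  the point \<open>\<langle>v\<rangle>\<close> is the set of all multiples of the nonzero vector \<open>v\<close>.\<close>

definition pt :: "'a::field vec \<Rightarrow> 'a vec set" where
  "pt v = {c \<cdot>\<^sub>v v | c. True}"

text \<open>The points of \<open>PG(m-1, K)\<close> for a subfield \<open>K\<close>, as the canonical subgeometry of those points
  of the \<open>PG(m-1)\<close> over \<open>'a\<close> that have coordinates in \<open>K\<close>.\<close>

definition PG_points :: "'a::field set \<Rightarrow> nat \<Rightarrow> 'a vec set set" where
  "PG_points K m = {pt v | v. v \<in> carrier_vec m \<and> v \<noteq> 0\<^sub>v m \<and> (\<forall>i<m. v $ i \<in> K)}"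

definition mat_image :: "'a::field mat \<Rightarrow> 'a vec set set \<Rightarrow> 'a vec set set" where
  "mat_image A X = (\<lambda>P. (\<lambda>v. A *\<^sub>v v) ` P) ` X"

definition projectivity_mat :: "nat \<Rightarrow> 'a::field mat \<Rightarrow> bool" where
  "projectivity_mat m A \<longleftrightarrow> A \<in> carrier_mat m m \<and> invertible_mat A"

text \<open>The standard normal rational curve of order \<open>n\<close> over \<open>K\<close>, in the \<open>n\<close>-subspace spanned by the
  first \<open>n + 1\<close> coordinate vectors of \<open>PG(m-1, K)\<close>.\<close>

definition std_nrc :: "'a::field set \<Rightarrow> nat \<Rightarrow> nat \<Rightarrow> 'a vec set set" where
  "std_nrc K m n =
     {pt (vec m (\<lambda>i. if i \<le> n then y ^ i else 0)) | y. y \<in> K} \<union> {pt (unit_vec m n)}"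

text \<open>Normal rational curves of order \<open>m - 1\<close> of \<open>PG(m-1)\<close> over \<open>'a\<close>.\<close>

definition is_nrc :: "nat \<Rightarrow> 'a::field vec set set \<Rightarrow> bool" where
  "is_nrc m C \<longleftrightarrow> (\<exists>A. projectivity_mat m A \<and> C = mat_image A (std_nrc UNIV m (m - 1)))"

text \<open>Normal rational curves of order \<open>n\<close> contained in a canonical subgeometry \<open>S\<close> of order \<open>q\<close>:
  they are taken with respect to the structure of \<open>PG(m-1, q)\<close> carried by \<open>S\<close>, i.e.\ they are
  images of the standard curve over the small field under a projectivity that identifies
  \<open>PG(m-1, q)\<close> with \<open>S\<close>.\<close>

definition is_nrc_in :: "nat \<Rightarrow> nat \<Rightarrow> 'a::field vec set set \<Rightarrow> nat \<Rightarrow> 'a vec set set \<Rightarrow> bool" where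
  "is_nrc_in q m S n C \<longleftrightarrow>
     (\<exists>A. projectivity_mat m A \<and> mat_image A (PG_points (Fq q) m) = S \<and>
          C = mat_image A (std_nrc (Fq q) m n))"


subsection \<open>The subgeometry and its projection\<close>

definition subgeom :: "nat \<Rightarrow> nat \<Rightarrow> nat \<Rightarrow> 'a::field vec set set" where
  "subgeom q t \<nu> = {pt (vec t (\<lambda>i. (frob q \<nu> ^^ i) l)) | l. l \<noteq> 0}"

definition Gam :: "nat \<Rightarrow> 'a::field vec set" where
  "Gam t = {x \<in> carrier_vec t. x $ (t - 2) = 0 \<and> x $ (t - 1) = 0}"

definition line0 :: "nat \<Rightarrow> 'a::field vec set" where
  "line0 t = {x \<in> carrier_vec t. \<forall>i < t - 2. x $ i = 0}"

definition join :: "'a::field vec set \<Rightarrow> 'a vec set \<Rightarrow> 'a vec set" where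
  "join U W = {u + w | u w. u \<in> U \<and> w \<in> W}"

text \<open>Projection from \<open>Gam t\<close> to \<open>line0 t\<close>; meaningful for points not in \<open>Gam t\<close>.\<close>

definition proj :: "nat \<Rightarrow> 'a::field vec set \<Rightarrow> 'a vec set" where
  "proj t P = join (Gam t) P \<inter> line0 t"

text \<open>The point of \<open>line0 t\<close> with coordinates \<open>(x_{t-1}, x_t) = (a, b)\<close>.\<close>

definition line0_pt :: "nat \<Rightarrow> 'a::field \<Rightarrow> 'a \<Rightarrow> 'a vec set" where
  "line0_pt t a b = pt (vec t (\<lambda>i. if i = t - 2 then a else if i = t - 1 then b else 0))"

definition lin_set :: "nat \<Rightarrow> nat \<Rightarrow> nat \<Rightarrow> 'a::field vec set set" where
  "lin_set q t \<nu> = {line0_pt t \<mu> (frob q \<nu> \<mu>) | \<mu>. \<mu> \<noteq> 0}"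

definition is_subline :: "nat \<Rightarrow> nat \<Rightarrow> 'a::field vec set set \<Rightarrow> bool" where
  "is_subline q t r \<longleftrightarrow>
     (\<exists>\<alpha> \<beta> \<gamma> \<delta>. \<alpha> * \<delta> - \<beta> * \<gamma> \<noteq> 0 \<and>
        r = {line0_pt t (\<alpha> * a + \<beta> * b) (\<gamma> * a + \<delta> * b) | a b.
               a \<in> Fq q \<and> b \<in> Fq q \<and> (a, b) \<noteq> (0, 0)})"

definition P_Gam :: "nat \<Rightarrow> 'a::field vec set" where
  "P_Gam t = pt (unit_vec t 0)"

definition shat :: "nat \<Rightarrow> nat \<Rightarrow> nat \<Rightarrow> 'a::field vec set \<Rightarrow> 'a vec set" where
  "shat q t \<nu> P =
     (\<lambda>x. vec t (\<lambda>i. frob q \<nu> (x $ (if i = 0 then t - 1 else i - 1)))) ` P"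


subsection \<open>Field reduction\<close>

text \<open>The space \<open>PG(2t-1, q)\<close> is that of the \<open>Fq q\<close>-vector space \<open>'a \<times> 'a\<close>. Its points are
  \<open>qpt q a b\<close> for \<open>(a, b) \<noteq> (0, 0)\<close>, and its other subspaces are represented by their sets of
  points.\<close>

definition qpt :: "nat \<Rightarrow> 'a::field \<Rightarrow> 'a \<Rightarrow> ('a \<times> 'a) set" where
  "qpt q a b = {(c * a, c * b) | c. c \<in> Fq q}"

definition is_qline :: "nat \<Rightarrow> ('a::field \<times> 'a) set set \<Rightarrow> bool" where
  "is_qline q f \<longleftrightarrow>
     (\<exists>a b c d. (a, b) \<noteq> (0, 0) \<and> (c, d) \<noteq> (0, 0) \<and> qpt q a b \<noteq> qpt q c d \<and>
        f = {qpt q (x * a + y * c) (x * b + y * d) | x y.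
               x \<in> Fq q \<and> y \<in> Fq q \<and> (x, y) \<noteq> (0, 0)})"

definition field_red :: "nat \<Rightarrow> nat \<Rightarrow> 'a::field vec set \<Rightarrow> ('a \<times> 'a) set set" where
  "field_red q t X =
     {qpt q (z * a) (z * b) | a b z. (a, b) \<noteq> (0, 0) \<and> X = line0_pt t a b \<and> z \<noteq> 0}"

definition B_set :: "nat \<Rightarrow> nat \<Rightarrow> ('a::field \<times> 'a) set set \<Rightarrow> 'a vec set set" where
  "B_set q t f = {X. (\<exists>a b. (a, b) \<noteq> (0, 0) \<and> X = line0_pt t a b) \<and> field_red q t X \<inter> f \<noteq> {}}"

definition S_sub :: "nat \<Rightarrow> nat \<Rightarrow> 'a::field \<Rightarrow> ('a \<times> 'a) set set" where
  "S_sub q h k = {qpt q z (k * z ^ (q ^ h)) | z. z \<noteq> 0}"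

definition S_fam :: "nat \<Rightarrow> nat \<Rightarrow> nat \<Rightarrow> ('a::field \<times> 'a) set set set" where
  "S_fam q t h = {S_sub q h k | k. field_norm q t k = 1}"

definition line_in_fam :: "nat \<Rightarrow> nat \<Rightarrow> nat \<Rightarrow> ('a::field \<times> 'a) set set \<Rightarrow> bool" where
  "line_in_fam q t h f \<longleftrightarrow> is_qline q f \<and> (\<exists>S \<in> S_fam q t h. f \<subseteq> S)"

definition preim :: "nat \<Rightarrow> nat \<Rightarrow> nat \<Rightarrow> ('a::field \<times> 'a) set set \<Rightarrow> 'a vec set set" where
  "preim q t \<nu> f = {P \<in> subgeom q t \<nu>. proj t P \<in> B_set q t f}"

end

theory Submission
  imports Defs "HOL-Number_Theory.Residues" "Jordan_Normal_Form.Determinant"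
begin

text \<open>
  Let \<open>V l\<close> be the vector of all conjugates of \<open>l\<close> under \<open>\<sigma>\<close>, and \<open>Q n w\<close> the product of the first \<open>n\<close>
  conjugates of \<open>w\<close>. Let \<open>F\<close> be the subfield of order \<open>q\<close>. By Hilbert 90 a line in an
  element of \<open>S_h\<close> gives the points \<open>(w, w ^ (q ^ h))\<close>, where \<open>w\<close> runs over a two-dimensional
  \<open>F\<close>-space \<open>W\<close>. If \<open>h = n \<nu>\<close> modulo \<open>t\<close>, this point equals \<open>(\<mu>, \<sigma> \<mu>)\<close> with \<open>\<mu> = Q n w\<close>, and
  \<open>Q n (x a + y c)\<close> is a form of degree \<open>n\<close> in \<open>(x, y)\<close>. The curve \<open>V (Q n w)\<close> is normal rational
  because the coefficients of this form are independent over \<open>F\<close>.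

  For \<open>n = t - 1\<close>, \<open>Q n w\<close> is, up to a factor in \<open>F\<close>, the inverse of a conjugate of \<open>w\<close>. Hence the
  curve is the image of a subline of the subgeometry under coordinatewise inversion, and that
  map takes normal rational curves through the coordinate points to lines.
\<close>

subsection \<open>The subfield of order q\<close>

text \<open>A relation with coefficients in \<open>F\<close> is fixed by \<open>\<sigma>\<close>, so
  it holds for all conjugates at once. Hence a relation over \<open>F\<close> between the
  coefficients of \<open>Q n (x * a + y * c)\<close>, as a form in \<open>(x, y)\<close>,
  annihilates every product of \<open>n\<close> consecutive conjugate linear forms, and these
  products span all forms of degree \<open>n\<close> because their factors are pairwise independent.
  That independence is where primality of \<open>t\<close> acts: every \<open>\<sigma> ^^ i\<close>
  with \<open>t\<close> not dividing \<open>i\<close> has fixed field exactly \<open>F\<close>. A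
  basis over \<open>F\<close> gives an invertible Moore matrix, which is the projectivity from the
  standard subgeometry to \<open>\<Sigma>\<close> that the definition of a curve in
  \<open>\<Sigma>\<close> asks for. The order of \<open>F\<close>, Hilbert 90 and extension to a
  basis all come from counting in the finite field. The recurring shift by
  \<open>\<sigma> ^^ 2\<close> has a plain origin: the projection keeps the last two coordinates,
  whose exponents are \<open>-2\<close> and \<open>-1\<close> modulo \<open>t\<close>.\<close>

lemma card_le_mult_card_image:
  assumes "finite A" and "\<And>y. card {x \<in> A. f x = y} \<le> d"
  shows "card A \<le> d * card (f ` A)"
proof -
  have "A = (\<Union>y\<in>f ` A. {x \<in> A. f x = y})"
    by auto
  then have "card A \<le> (\<Sum>y\<in>f ` A. card {x \<in> A. f x = y})"
    using card_UN_le[of "f ` A" "\<lambda>y. {x \<in> A. f x = y}"] assms(1) by simp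
  also have "\<dots> \<le> (\<Sum>y\<in>f ` A. d)"
    by (rule sum_mono) (use assms(2) in auto)
  finally show ?thesis
    by (simp add: mult.commute)
qed

lemma card_roots_power_le:
  fixes c :: "'a::field"
  assumes "d > 0"
  shows "card {x. x ^ d = c} \<le> d"
proof -
  let ?p = "Polynomial.monom 1 d - [:c:] :: 'a poly"
  have "poly.coeff ?p d = 1"
    using assms by (cases d) auto
  then have nz: "?p \<noteq> 0"
    by force
  have "degree ?p \<le> d"
    by (rule degree_diff_le) (auto simp: degree_monom_eq)
  moreover have "{x. poly ?p x = 0} = {x. x ^ d = c}"
    by (auto simp: poly_monom)
  ultimately show ?thesis
    using card_poly_roots_bound[OF nz] by simp
qed

section \<open>Matrices and projective points in coordinates\<close>

lemma invertible_matI: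
  fixes A :: "'a::field mat"
  assumes A: "A \<in> carrier_mat n n"
    and inj: "\<And>v. v \<in> carrier_vec n \<Longrightarrow> A *\<^sub>v v = 0\<^sub>v n \<Longrightarrow> v = 0\<^sub>v n"
  shows "projectivity_mat n A"
proof -
  have "Determinant.det A \<noteq> 0"
    using det_0_iff_vec_prod_zero_field[OF A] inj by blast
  then have "A \<in> Units (ring_mat TYPE('a) n ())"
    by (rule det_non_zero_imp_unit[OF A])
  then obtain B where "B \<in> carrier_mat n n" "A * B = 1\<^sub>m n" "B * A = 1\<^sub>m n"
    by (auto simp: Units_def ring_mat_def)
  then show ?thesis
    using A by (auto simp: projectivity_mat_def invertible_mat_def inverts_mat_def)
qed

lemma projectivity_mat_inj:
  assumes "projectivity_mat n A" and v: "v \<in> carrier_vec n" and "A *\<^sub>v v = 0\<^sub>v n"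
  shows "v = 0\<^sub>v n"
proof -
  have A: "A \<in> carrier_mat n n" and "invertible_mat A"
    using assms(1) by (auto simp: projectivity_mat_def)
  then obtain B where B: "A * B = 1\<^sub>m n" "B * A = 1\<^sub>m (dim_row B)"
    by (auto simp: invertible_mat_def inverts_mat_def)
  \<comment> \<open>\<open>invertible_mat\<close> leaves the size of its witness open; comparing
    column numbers in the two equations fixes it.\<close>
  have "dim_col B = n" "dim_row B = n"
    using A arg_cong[OF B(1), of dim_col] arg_cong[OF B(2), of dim_col] by auto
  then have B': "B \<in> carrier_mat n n" "B * A = 1\<^sub>m n"
    using B by auto
  have "v = (B * A) *\<^sub>v v"
    using B' v by simp
  also have "\<dots> = B *\<^sub>v (A *\<^sub>v v)"
    using A B' v by (intro assoc_mult_mat_vec) auto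
  also have "\<dots> = 0\<^sub>v n"
    using assms(3) B' by auto
  finally show ?thesis .
qed

lemma pt_image:
  assumes "A \<in> carrier_mat n m" "v \<in> carrier_vec m"
  shows "(\<lambda>v. A *\<^sub>v v) ` pt v = pt (A *\<^sub>v v)"
proof -
  have "A *\<^sub>v (c \<cdot>\<^sub>v v) = c \<cdot>\<^sub>v (A *\<^sub>v v)" for c
    using assms by (rule mult_mat_vec)
  then show ?thesis
    unfolding pt_def by (auto simp: image_iff; metis)
qed

lemma pt_smult:
  fixes c :: "'a::field"
  assumes "c \<noteq> 0"
  shows "pt (c \<cdot>\<^sub>v v) = pt v"
proof -
  have "d \<cdot>\<^sub>v v = (d / c) \<cdot>\<^sub>v (c \<cdot>\<^sub>v v)" "d \<cdot>\<^sub>v (c \<cdot>\<^sub>v v) = (d * c) \<cdot>\<^sub>v v" for d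
    using assms by (simp_all add: smult_smult_assoc)
  then show ?thesis
    unfolding pt_def by blast
qed

lemma mem_pt: "(v::'a::field vec) \<in> pt v"
  unfolding pt_def by (force intro: exI[of _ 1])

text \<open>The nonzero entry \<open>f j\<close> serves to exclude the scalar 0, since
  \<open>pt\<close> also contains the zero vector.\<close>

lemma pt_vec_eqD:
  fixes f g :: "nat \<Rightarrow> 'a::field"
  assumes "pt (vec n f) = pt (vec n g)" "j < n" "f j \<noteq> 0"
  obtains c where "c \<noteq> 0" "\<And>i. i < n \<Longrightarrow> f i = c * g i"
proof -
  have "vec n f \<in> pt (vec n g)"
    using assms(1) mem_pt by metis
  then obtain c where c: "vec n f = c \<cdot>\<^sub>v vec n g"
    by (auto simp: pt_def)
  have "f i = c * g i" if "i < n" for i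
    using arg_cong[OF c, of "\<lambda>v. v $ i"] that by simp
  moreover from this[OF assms(2)] assms(3) have "c \<noteq> 0"
    by auto
  ultimately show thesis
    using that by blast
qed

lemma pt_vec_eqI:
  fixes f g :: "nat \<Rightarrow> 'a::field"
  assumes "c \<noteq> 0" "\<And>i. i < n \<Longrightarrow> f i = c * g i"
  shows "pt (vec n f) = pt (vec n g)"
proof -
  have "vec n f = c \<cdot>\<^sub>v vec n g"
    using assms(2) by auto
  then show ?thesis
    using pt_smult[OF assms(1)] by metis
qed

lemma line0_pt_smult:
  fixes c :: "'a::field"
  assumes "c \<noteq> 0"
  shows "line0_pt t (c * a) (c * b) = line0_pt t a b"
  unfolding line0_pt_def by (rule pt_vec_eqI[OF assms]) auto

lemma line0_pt_eqD:
  fixes a b a' b' :: "'a::field"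
  assumes "line0_pt t a b = line0_pt t a' b'" "(a, b) \<noteq> (0, 0)" "2 \<le> t"
  obtains c where "c \<noteq> 0" "a = c * a'" "b = c * b'"
proof -
  obtain j where j: "j < t" "(if j = t - 2 then a else if j = t - 1 then b else 0) \<noteq> 0"
  proof (cases "a = 0")
    case True
    then show ?thesis
      using assms that[of "t - 1"] by auto
  next
    case False
    then show ?thesis
      using assms that[of "t - 2"] by auto
  qed
  from pt_vec_eqD[OF assms(1)[unfolded line0_pt_def] j]
  obtain c where c: "c \<noteq> 0" and *: "\<And>i. i < t \<Longrightarrow>
      (if i = t - 2 then a else if i = t - 1 then b else 0) =
      c * (if i = t - 2 then a' else if i = t - 1 then b' else 0)"
    by blast
  have "a = c * a'" "b = c * b'"
    using *[of "t - 2"] *[of "t - 1"] assms(3) by (auto split: if_splits)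
  with c that show thesis
    by blast
qed

text \<open>This is what makes raising to the power \<open>q\<close> additive: the characteristic
  divides the order of the field, so it is the only prime dividing \<open>q\<close>.\<close>

lemma field_card_CHAR:
  fixes q t :: nat
  assumes "primepow q" "card (UNIV :: 'a::finite_field set) = q ^ t"
  obtains k where "q = CHAR('a) ^ k" "k > 0"
proof -
  obtain p k where p: "prime p" "k > 0" "q = p ^ k"
    using assms(1) unfolding primepow_def by blast
  have "prime CHAR('a)"
    by (rule prime_CHAR_semidom) (simp add: CHAR_pos)
  moreover have "CHAR('a) dvd p ^ (k * t)"
    using CHAR_dvd_CARD[where ?'a = 'a] assms(2) p by (simp add: power_mult)
  ultimately have "CHAR('a) dvd p"
    using prime_dvd_power by blast
  then have "CHAR('a) = p"
    using \<open>prime CHAR('a)\<close> p(1) primes_dvd_imp_eq by blast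
  then show thesis
    using that p by simp
qed

section \<open>Powers of the Frobenius map, their fixed field and the norm\<close>

locale field_ext =
  fixes q t \<nu> :: nat and \<sigma> :: "'a::finite_field \<Rightarrow> 'a" and F :: "'a set"
  assumes t_prime: "prime t" and t3: "3 \<le> t" and q_pp: "primepow q"
    and card_UNIV: "card (UNIV :: 'a set) = q ^ t"
    and cop: "coprime \<nu> t"
    and sigma_def: "\<sigma> = frob q \<nu>" and F_def: "F = Fq q"
begin

lemma q1: "q > 1"
  using q_pp primepow_gt_Suc_0 by auto

lemma frob_funpow: "(frob q m ^^ i) (x::'a) = x ^ (q ^ (m * i))"
proof (induction i)
  case (Suc i)
  then show ?case
    by (simp add: frob_def power_add mult.commute flip: power_mult)
qed simp

lemma pow_add: "((x::'a) + y) ^ (q ^ m) = x ^ (q ^ m) + y ^ (q ^ m)"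
proof -
  obtain k where "q = CHAR('a) ^ k"
    using field_card_CHAR[OF q_pp card_UNIV] by blast
  then have "q ^ m = CHAR('a) ^ (k * m)"
    by (simp add: power_mult)
  moreover have "prime CHAR('a)"
    by (rule prime_CHAR_semidom) (simp add: CHAR_pos)
  ultimately show ?thesis
    using freshmans_dream' by blast
qed

lemma sigma_funpow: "(\<sigma> ^^ i) x = x ^ (q ^ (\<nu> * i))"
  by (simp add: sigma_def frob_funpow)

lemma s_add [simp]: "(\<sigma> ^^ i) (x + y) = (\<sigma> ^^ i) x + (\<sigma> ^^ i) y"
  by (simp add: sigma_funpow pow_add)

lemma s_mult [simp]: "(\<sigma> ^^ i) (x * y) = (\<sigma> ^^ i) x * (\<sigma> ^^ i) y"
  by (simp add: sigma_funpow power_mult_distrib)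

lemma s_0 [simp]: "(\<sigma> ^^ i) 0 = 0"
  using q1 by (simp add: sigma_funpow)

lemma s_1 [simp]: "(\<sigma> ^^ i) 1 = 1"
  by (simp add: sigma_funpow)

lemma s_diff [simp]: "(\<sigma> ^^ i) (x - y) = (\<sigma> ^^ i) x - (\<sigma> ^^ i) y"
  using s_add[of i "x - y" y] by (simp add: algebra_simps)

lemma s_divide [simp]: "(\<sigma> ^^ i) (x / y) = (\<sigma> ^^ i) x / (\<sigma> ^^ i) y"
  by (simp add: sigma_funpow power_divide)

lemma s_inverse [simp]: "(\<sigma> ^^ i) (inverse y) = inverse ((\<sigma> ^^ i) y)"
  by (simp add: sigma_funpow power_inverse)

lemma s_eq_0_iff [simp]: "(\<sigma> ^^ i) x = 0 \<longleftrightarrow> x = 0"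
  using q1 by (simp add: sigma_funpow)

lemma s_sum: "(\<sigma> ^^ i) (\<Sum>j\<in>A. f j) = (\<Sum>j\<in>A. (\<sigma> ^^ i) (f j))"
  by (induction A rule: infinite_finite_induct) auto

lemma s_prod: "(\<sigma> ^^ i) (\<Prod>j\<in>A. f j) = (\<Prod>j\<in>A. (\<sigma> ^^ i) (f j))"
  by (induction A rule: infinite_finite_induct) auto

lemma s_s: "(\<sigma> ^^ i) ((\<sigma> ^^ j) x) = (\<sigma> ^^ (i + j)) x"
  by (simp add: funpow_add)

lemma sigma_s: "\<sigma> ((\<sigma> ^^ j) x) = (\<sigma> ^^ Suc j) x"
  by simp

lemma pow_qt: "(x::'a) ^ (q ^ (t * m)) = x"
  by (rule finite_field_power_card_power_eq_same) (simp add: card_UNIV power_mult)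

lemma s_t [simp]: "(\<sigma> ^^ t) x = x"
  by (metis sigma_funpow pow_qt mult.commute)

lemma s_add_t [simp]: "(\<sigma> ^^ (i + t)) x = (\<sigma> ^^ i) x"
  by (simp add: funpow_add)

lemma s_mod: "(\<sigma> ^^ (i mod t)) x = (\<sigma> ^^ i) x"
  by (rule funpow_mod_eq) simp

lemma F_iff: "x \<in> F \<longleftrightarrow> x ^ q = x"
  by (simp add: F_def Fq_def)

lemma F_pow: "x \<in> F \<Longrightarrow> x ^ (q ^ m) = x"
  by (induction m) (auto simp: F_iff power_mult)

lemma s_F: "x \<in> F \<Longrightarrow> (\<sigma> ^^ i) x = x"
  by (simp add: sigma_funpow F_pow)

text \<open>As \<open>t\<close> is prime, \<open>m\<close> is coprime to \<open>t\<close>, and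
  Bezout gives \<open>m * u = t * v + 1\<close>. The element is fixed by the power
  \<open>q ^ (m * u)\<close>, while the power \<open>q ^ (t * v)\<close> is the identity, so only
  \<open>x ^ q = x\<close> remains.\<close>

lemma fixed_pow_imp_F:
  fixes x :: 'a
  assumes "x ^ (q ^ m) = x" "\<not> t dvd m"
  shows "x \<in> F"
proof -
  have "coprime m t"
    using assms(2) t_prime prime_imp_coprime coprime_commute by blast
  moreover have "m \<noteq> 0"
    using assms(2) by (metis dvd_0_right)
  ultimately obtain u v where uv: "m * u = t * v + 1"
    using bezout_nat[of m t] by auto
  have "x ^ (q ^ (m * k)) = x" for k
  proof (induction k)
    case (Suc k)
    have "x ^ (q ^ (m * Suc k)) = (x ^ (q ^ m)) ^ (q ^ (m * k))"
      by (simp add: power_add flip: power_mult)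
    then show ?case
      using Suc assms(1) by simp
  qed simp
  then have "x ^ (q ^ (t * v + 1)) = x"
    using uv by metis
  moreover have "x ^ (q ^ (t * v + 1)) = (x ^ (q ^ (t * v))) ^ q"
    by (simp add: power_add mult.commute flip: power_mult)
  ultimately show ?thesis
    by (simp add: F_iff pow_qt)
qed

lemma not_dvd_nu: "\<not> t dvd \<nu>"
  using cop t_prime t3 by (metis coprime_absorb_right dvd_1_iff_1 not_prime_unit)

lemma fixed_imp_F:
  assumes "(\<sigma> ^^ i) x = x" "\<not> t dvd i"
  shows "x \<in> F"
proof (rule fixed_pow_imp_F)
  show "x ^ (q ^ (\<nu> * i)) = x"
    using assms(1) by (simp add: sigma_funpow)
  show "\<not> t dvd \<nu> * i"
    using assms(2) not_dvd_nu t_prime by (simp add: prime_dvd_mult_iff)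
qed

lemma F_0 [simp]: "0 \<in> F" and F_1 [simp]: "1 \<in> F"
  using q1 by (auto simp: F_iff)

lemma F_mult: "x \<in> F \<Longrightarrow> y \<in> F \<Longrightarrow> x * y \<in> F"
  by (simp add: F_iff power_mult_distrib)

lemma F_divide: "x \<in> F \<Longrightarrow> y \<in> F \<Longrightarrow> x / y \<in> F"
  by (simp add: F_iff power_divide)

text \<open>Additive closure is seen by viewing \<open>F\<close> as the fixed set of a power of
  \<open>\<sigma>\<close>, which is additive.\<close>

lemma F_minus: "x \<in> F \<Longrightarrow> y \<in> F \<Longrightarrow> x - y \<in> F"
  by (metis fixed_imp_F s_F s_diff not_dvd_nu mult_1_right dvd_mult_unit_iff nat_dvd_1_iff_1 t3 numeral_le_one_iff semiring_norm(70))

lemma F_uminus: "x \<in> F \<Longrightarrow> - x \<in> F"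
  using F_minus[of 0 x] by simp

lemma norm_exp: "(q ^ t - 1) div (q - 1) * (q - 1) = q ^ t - 1"
proof -
  have "[q ^ t = 1 ^ t] (mod (q - 1))"
    by (rule cong_pow) (use q1 in \<open>auto simp: cong_altdef_nat\<close>)
  then have "q - 1 dvd q ^ t - 1"
    using q1 by (simp add: cong_altdef_nat)
  then show ?thesis
    by simp
qed

lemma norm_exp_pos: "(q ^ t - 1) div (q - 1) > 0"
proof -
  have "q ^ t > 1"
    using q1 t3 by (intro one_less_power) auto
  then show ?thesis
    using norm_exp by (metis mult_0 neq0_conv zero_less_diff less_irrefl)
qed

lemma pow_qt1: "(x::'a) \<noteq> 0 \<Longrightarrow> x ^ (q ^ t - 1) = 1"
proof -
  assume x: "x \<noteq> 0"
  have "x * x ^ (q ^ t - 1) = x ^ Suc (q ^ t - 1)"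
    by simp
  also have "\<dots> = x"
    using pow_qt[of x 1] q1 by simp
  finally show ?thesis
    using x by simp
qed

lemma F_units: "F - {0} = {x. x ^ (q - 1) = 1}"
proof -
  have "x ^ q = x * x ^ (q - 1)" for x :: 'a
    using q1 by (metis Suc_diff_1 gr0I not_less_zero power_Suc)
  then show ?thesis
    using q1 by (auto simp: F_iff power_0_left)
qed

lemma card_nz: "card (UNIV - {0::'a}) = q ^ t - 1"
  by (simp add: card_Diff_singleton card_UNIV)

lemma norm_power_units: "(x::'a) \<noteq> 0 \<Longrightarrow> (x ^ ((q ^ t - 1) div (q - 1))) ^ (q - 1) = 1"
  using pow_qt1 norm_exp by (metis power_mult)

text \<open>The norm map has fibres of at most \<open>?M\<close> elements, so its image inside
  \<open>F - {0}\<close> has at least \<open>q - 1\<close>; the reverse bound counts roots of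
  \<open>x ^ (q - 1) = 1\<close>.\<close>

lemma card_F: "card F = q"
proof -
  let ?M = "(q ^ t - 1) div (q - 1)"
  have "card (UNIV - {0::'a}) \<le> ?M * card ((\<lambda>x::'a. x ^ ?M) ` (UNIV - {0}))"
  proof (rule card_le_mult_card_image)
    fix y :: 'a
    have "card {x \<in> UNIV - {0}. x ^ ?M = y} \<le> card {x. x ^ ?M = y}"
      by (rule card_mono) auto
    then show "card {x \<in> UNIV - {0}. x ^ ?M = y} \<le> ?M"
      using card_roots_power_le[OF norm_exp_pos, of y] by simp
  qed simp
  also have "(\<lambda>x::'a. x ^ ?M) ` (UNIV - {0}) \<subseteq> F - {0}"
    unfolding F_units using norm_power_units by auto
  then have "card ((\<lambda>x::'a. x ^ ?M) ` (UNIV - {0})) \<le> card (F - {0})"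
    by (rule card_mono[rotated]) simp
  finally have "?M * (q - 1) \<le> ?M * card (F - {0})"
    using norm_exp card_nz by simp
  then have "q - 1 \<le> card (F - {0})"
    using norm_exp_pos by simp
  moreover have "card (F - {0}) \<le> q - 1"
    unfolding F_units by (rule card_roots_power_le) (use q1 in simp)
  ultimately show ?thesis
    using q1 by (simp add: card_Diff_singleton)
qed

text \<open>Two arguments with the same value under \<open>?f\<close> have a quotient fixed by the
  power \<open>q ^ h\<close>, hence in \<open>F\<close>. So fibres have at most \<open>q - 1\<close>
  elements and the image has at least \<open>?M\<close>. It lies among the elements of norm 1, of
  which there are at most \<open>?M\<close>, so every such element is a value.\<close>

lemma hilbert_90:
  assumes "field_norm q t k = 1" "\<not> t dvd h"
  obtains m :: 'a where "m \<noteq> 0" "m ^ (q ^ h) = k * m"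
proof -
  let ?M = "(q ^ t - 1) div (q - 1)" and ?f = "\<lambda>x::'a. x ^ (q ^ h) / x"
  have "card (UNIV - {0::'a}) \<le> (q - 1) * card (?f ` (UNIV - {0}))"
  proof (rule card_le_mult_card_image)
    fix y :: 'a
    show "card {x \<in> UNIV - {0}. ?f x = y} \<le> q - 1"
    proof (cases "\<exists>x0. x0 \<noteq> 0 \<and> ?f x0 = y")
      case True
      then obtain x0 where x0: "x0 \<noteq> 0" "?f x0 = y"
        by blast
      have "{x \<in> UNIV - {0}. ?f x = y} \<subseteq> (\<lambda>c. c * x0) ` (F - {0})"
      proof
        fix x assume x: "x \<in> {x \<in> UNIV - {0}. ?f x = y}"
        then have "(x / x0) ^ (q ^ h) = x / x0"
          using x0 by (auto simp: power_divide field_simps)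
        then have "x / x0 \<in> F - {0}"
          using fixed_pow_imp_F assms(2) x x0 by auto
        then show "x \<in> (\<lambda>c. c * x0) ` (F - {0})"
          using x0 by (intro image_eqI[of _ _ "x / x0"]) auto
      qed
      then have "card {x \<in> UNIV - {0}. ?f x = y} \<le> card (F - {0})"
        by (meson card_image_le card_mono finite finite_imageI le_trans)
      then show ?thesis
        by (simp add: card_F card_Diff_singleton)
    next
      case False
      then have "{x \<in> UNIV - {0}. ?f x = y} = {}"
        by auto
      then show ?thesis
        by (metis card.empty le0)
    qed
  qed simp
  then have "(q - 1) * ?M \<le> (q - 1) * card (?f ` (UNIV - {0}))"
    using norm_exp card_nz by (simp add: mult.commute)
  then have "?M \<le> card (?f ` (UNIV - {0}))"
    using q1 by simp
  moreover have sub: "?f ` (UNIV - {0}) \<subseteq> {x. x ^ ?M = 1}"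
  proof (rule image_subsetI)
    fix x :: 'a assume "x \<in> UNIV - {0}"
    then have x: "x \<noteq> 0"
      by simp
    \<comment> \<open>The norm lies in \<open>F\<close>, so numerator and denominator of
      \<open>?f x\<close> have equal norms.\<close>
    have "(x ^ ?M) ^ q = x ^ ?M"
      using norm_power_units[OF x] F_units F_iff by auto
    then have "(x ^ ?M) ^ (q ^ h) = x ^ ?M"
      using F_pow F_iff by blast
    then show "?f x \<in> {x. x ^ ?M = 1}"
      using x by (simp add: power_divide mult.commute flip: power_mult)
  qed
  moreover have "card {x::'a. x ^ ?M = 1} \<le> ?M"
    by (rule card_roots_power_le[OF norm_exp_pos])
  ultimately have "?f ` (UNIV - {0}) = {x. x ^ ?M = 1}"
    by (intro card_subset_eq) (auto dest: card_mono[rotated])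
  then have "k \<in> ?f ` (UNIV - {0})"
    using assms(1) by (simp add: field_norm_def)
  then obtain x where "x \<noteq> 0" "k = x ^ (q ^ h) / x"
    by blast
  then show thesis
    using that[of x] by simp
qed

end

subsection \<open>Moore matrices and products of conjugate linear forms\<close>

lemma coeff_linear_mult:
  fixes P :: "'a::comm_ring_1 poly"
  shows "poly.coeff ([:x, y:] * P) j =
    x * poly.coeff P j + (case j of 0 \<Rightarrow> 0 | Suc j' \<Rightarrow> y * poly.coeff P j')"
  by (cases j) auto

text \<open>The coefficient is taken at \<open>card A\<close> and not at the degree, so that factors
  with \<open>\<gamma> k = 0\<close> are covered; these occur for a parameter at infinity. Both
  claims share one induction because the coefficient step uses the degree bound.\<close>

lemma prod_linear_degree_coeff:
  fixes \<alpha> \<gamma> :: "'b \<Rightarrow> 'a::field"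
  assumes "finite A"
  shows "degree (\<Prod>k\<in>A. [:\<alpha> k, \<gamma> k:]) \<le> card A"
    and "poly.coeff (\<Prod>k\<in>A. [:\<alpha> k, \<gamma> k:]) (card A) = (\<Prod>k\<in>A. \<gamma> k)"
proof -
  have "degree (\<Prod>k\<in>A. [:\<alpha> k, \<gamma> k:]) \<le> card A \<and>
    poly.coeff (\<Prod>k\<in>A. [:\<alpha> k, \<gamma> k:]) (card A) = (\<Prod>k\<in>A. \<gamma> k)"
    using assms
  proof (induction A rule: finite_induct)
    case (insert x A)
    let ?P = "\<Prod>k\<in>A. [:\<alpha> k, \<gamma> k:]"
    have "degree ([:\<alpha> x, \<gamma> x:] * ?P) \<le> degree [:\<alpha> x, \<gamma> x:] + degree ?P"
      by (rule degree_mult_le)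
    also have "\<dots> \<le> 1 + card A"
      using insert by (intro add_mono) auto
    finally have "degree ([:\<alpha> x, \<gamma> x:] * ?P) \<le> Suc (card A)"
      by simp
    moreover have "poly.coeff ([:\<alpha> x, \<gamma> x:] * ?P) (Suc (card A)) = \<gamma> x * (\<Prod>k\<in>A. \<gamma> k)"
      using insert by (simp add: coeff_linear_mult coeff_eq_0 del: mult_pCons_left)
    ultimately show ?case
      using insert by (simp del: mult_pCons_left)
  qed simp
  then show "degree (\<Prod>k\<in>A. [:\<alpha> k, \<gamma> k:]) \<le> card A"
    and "poly.coeff (\<Prod>k\<in>A. [:\<alpha> k, \<gamma> k:]) (card A) = (\<Prod>k\<in>A. \<gamma> k)"
    by auto
qed

lemma poly_eq_sum_atMost:
  fixes p :: "'a::comm_ring_1 poly"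
  assumes "degree p \<le> n"
  shows "poly p y = (\<Sum>j\<le>n. poly.coeff p j * y ^ j)"
  unfolding poly_altdef
  by (rule sum.mono_neutral_left) (use assms in \<open>auto simp: coeff_eq_0\<close>)

text \<open>A sequence \<open>\<mu>\<close> acts as a linear functional on coefficients;
  multiplication by the variable turns into the shift of \<open>\<mu>\<close>.\<close>

lemma functional_linear_mult:
  fixes H :: "'a::field poly"
  assumes "degree H \<le> n"
  shows "(\<Sum>j\<le>Suc n. \<mu> j * poly.coeff ([:x, y:] * H) j) =
    x * (\<Sum>j\<le>n. \<mu> j * poly.coeff H j) + y * (\<Sum>j\<le>n. \<mu> (Suc j) * poly.coeff H j)"
proof -
  have H: "poly.coeff H (Suc n) = 0"
    using assms by (simp add: coeff_eq_0)
  have "(\<Sum>j\<le>Suc n. \<mu> j * poly.coeff ([:x, y:] * H) j) =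
    x * (\<Sum>j\<le>Suc n. \<mu> j * poly.coeff H j) +
    (\<Sum>j\<le>Suc n. \<mu> j * (case j of 0 \<Rightarrow> 0 | Suc j' \<Rightarrow> y * poly.coeff H j'))"
    unfolding coeff_linear_mult by (simp only: distrib_left sum.distrib sum_distrib_left mult_ac)
  also have "(\<Sum>j\<le>Suc n. \<mu> j * (case j of 0 \<Rightarrow> 0 | Suc j' \<Rightarrow> y * poly.coeff H j')) =
    y * (\<Sum>j\<le>n. \<mu> (Suc j) * poly.coeff H j)"
    by (subst sum.atMost_Suc_shift) (simp add: sum_distrib_left mult_ac)
  finally show ?thesis
    using H by simp
qed

text \<open>Consecutive windows of length \<open>n + 1\<close> share a window \<open>H\<close> of length \<open>n\<close>; the two remaining
  factors are independent, so the functional also vanishes on \<open>H\<close> and on \<open>H\<close> times the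
  variable.\<close>

lemma functional_windows_eq_0:
  fixes \<alpha> \<gamma> \<mu> :: "nat \<Rightarrow> 'a::field"
  assumes "\<And>i m. 0 < m \<Longrightarrow> m \<le> n \<Longrightarrow> \<alpha> i * \<gamma> (i + m) \<noteq> \<alpha> (i + m) * \<gamma> i"
    and "\<And>i. (\<Sum>j\<le>n. \<mu> j * poly.coeff (\<Prod>k<n. [:\<alpha> (i + k), \<gamma> (i + k):]) j) = 0"
    and "j \<le> n"
  shows "\<mu> j = 0"
  using assms
proof (induction n arbitrary: \<alpha> \<gamma> \<mu> j)
  case 0
  then show ?case
    by simp
next
  case (Suc n)
  define H where "H i = (\<Prod>k<n. [:\<alpha> (Suc i + k), \<gamma> (Suc i + k):])" for i
  have deg: "degree (H i) \<le> n" for i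
    unfolding H_def
    using prod_linear_degree_coeff(1)[of "{..<n}" "\<lambda>k. \<alpha> (Suc i + k)" "\<lambda>k. \<gamma> (Suc i + k)"] by simp
  have left: "(\<Prod>k<Suc n. [:\<alpha> (i + k), \<gamma> (i + k):]) = [:\<alpha> i, \<gamma> i:] * H i" for i
    unfolding H_def by (subst prod.lessThan_Suc_shift) simp
  have right: "(\<Prod>k<Suc n. [:\<alpha> (Suc i + k), \<gamma> (Suc i + k):]) =
      [:\<alpha> (Suc i + n), \<gamma> (Suc i + n):] * H i" for i
    unfolding H_def by (subst prod.lessThan_Suc) (simp only: mult.commute)
  have *: "(\<Sum>j\<le>n. \<mu> j * poly.coeff (H i) j) = 0 \<and> (\<Sum>j\<le>n. \<mu> (Suc j) * poly.coeff (H i) j) = 0" for i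
  proof -
    let ?P = "\<Sum>j\<le>n. \<mu> j * poly.coeff (H i) j" and ?Q = "\<Sum>j\<le>n. \<mu> (Suc j) * poly.coeff (H i) j"
    have 1: "\<alpha> i * ?P + \<gamma> i * ?Q = 0"
      using Suc.prems(2)[of i] unfolding left functional_linear_mult[OF deg] .
    have 2: "\<alpha> (Suc i + n) * ?P + \<gamma> (Suc i + n) * ?Q = 0"
      using Suc.prems(2)[of "Suc i"] unfolding right functional_linear_mult[OF deg] .
    have d: "\<alpha> i * \<gamma> (Suc i + n) - \<alpha> (Suc i + n) * \<gamma> i \<noteq> 0"
      using Suc.prems(1)[of "Suc n" i] by simp
    have "(\<alpha> i * \<gamma> (Suc i + n) - \<alpha> (Suc i + n) * \<gamma> i) * ?P =
        \<gamma> (Suc i + n) * (\<alpha> i * ?P + \<gamma> i * ?Q) - \<gamma> i * (\<alpha> (Suc i + n) * ?P + \<gamma> (Suc i + n) * ?Q)"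
      by (simp only: algebra_simps)
    then have P: "?P = 0"
      using d unfolding 1 2 by simp
    have "(\<alpha> i * \<gamma> (Suc i + n) - \<alpha> (Suc i + n) * \<gamma> i) * ?Q =
        \<alpha> i * (\<alpha> (Suc i + n) * ?P + \<gamma> (Suc i + n) * ?Q) - \<alpha> (Suc i + n) * (\<alpha> i * ?P + \<gamma> i * ?Q)"
      by (simp only: algebra_simps)
    then have "?Q = 0"
      using d unfolding 1 2 by simp
    with P show ?thesis
      by blast
  qed
  have dist: "\<alpha> (Suc i) * \<gamma> (Suc (i + m)) \<noteq> \<alpha> (Suc (i + m)) * \<gamma> (Suc i)" if "0 < m" "m \<le> n" for i m
    using Suc.prems(1)[of m "Suc i"] that by simp
  \<comment> \<open>The induction hypothesis is used for \<open>\<mu>\<close> and for its shift; the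
    shift supplies the top index \<open>Suc n\<close>.\<close>
  have "\<mu> j = 0" "\<mu> (Suc j) = 0" if "j \<le> n" for j
    using Suc.IH[of "\<lambda>i. \<alpha> (Suc i)" "\<lambda>i. \<gamma> (Suc i)" \<mu> j]
      Suc.IH[of "\<lambda>i. \<alpha> (Suc i)" "\<lambda>i. \<gamma> (Suc i)" "\<lambda>j. \<mu> (Suc j)" j]
      dist * that by (auto simp: H_def)
  then show ?case
    using Suc.prems(3) by (cases j) auto
qed

lemma mat_mult_vec_index:
  assumes "i < m" "v \<in> carrier_vec n"
  shows "(mat m n f *\<^sub>v v) $ i = (\<Sum>j<n. f (i, j) * v $ j)"
  using assms by (simp add: scalar_prod_def atLeast0LessThan)

section \<open>Linear independence over \<open>F\<close> and Moore matrices\<close>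

context field_ext
begin

lemma sigma_add: "\<sigma> (x + y) = \<sigma> x + \<sigma> y" and sigma_mult: "\<sigma> (x * y) = \<sigma> x * \<sigma> y"
  using s_add[of 1] s_mult[of 1] by simp_all

lemma sigma_sum: "\<sigma> (\<Sum>j\<in>A. f j) = (\<Sum>j\<in>A. \<sigma> (f j))"
  using s_sum[of 1] by simp

lemma not_dvd_less: "0 < m \<Longrightarrow> m < t \<Longrightarrow> \<not> t dvd m"
  by (auto dest: dvd_imp_le)

definition indep :: "(nat \<Rightarrow> 'a) \<Rightarrow> nat \<Rightarrow> bool" where
  "indep e n \<longleftrightarrow> (\<forall>l. (\<forall>j<n. l j \<in> F) \<longrightarrow> (\<Sum>j<n. l j * e j) = 0 \<longrightarrow> (\<forall>j<n. l j = 0))"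

lemma indepD:
  "indep e n \<Longrightarrow> (\<And>j. j < n \<Longrightarrow> l j \<in> F) \<Longrightarrow> (\<Sum>j<n. l j * e j) = 0 \<Longrightarrow> j < n \<Longrightarrow> l j = 0"
  unfolding indep_def by simp

lemma indep_Suc_imp: "indep e (Suc n) \<Longrightarrow> indep e n"
  unfolding indep_def[of e n]
proof (intro allI impI)
  fix l j
  assume H: "indep e (Suc n)" and l: "\<forall>j<n. l j \<in> F" "(\<Sum>j<n. l j * e j) = 0" and j: "j < n"
  have "(l(n := 0)) j = 0"
    using indepD[OF H, of "l(n := 0)" j] l j by simp
  then show "l j = 0"
    using j by simp
qed

text \<open>Normalise the last coefficient of a relation to \<open>1\<close>; subtracting the relation from its image
  under \<open>\<sigma>\<close> leaves a shorter one, so all coefficients are fixed by \<open>\<sigma>\<close> and lie in \<open>F\<close>.\<close>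

lemma moore_injective:
  assumes "indep e n" "\<And>i. (\<Sum>j<n. (\<sigma> ^^ i) (e j) * v j) = 0" "j < n"
  shows "v j = 0"
  using assms
proof (induction n arbitrary: v j)
  case (Suc n)
  note indep = indep_Suc_imp[OF Suc.prems(1)]
  have "v n = 0"
  proof (rule ccontr)
    assume vn: "v n \<noteq> 0"
    define w where "w j = v j / v n" for j
    have w: "(\<Sum>j<Suc n. (\<sigma> ^^ i) (e j) * w j) = 0" for i
      using arg_cong[OF Suc.prems(2)[of i], of "\<lambda>x. x / v n"]
      by (simp add: w_def sum_divide_distrib add_divide_distrib)
    have "w n = 1"
      using vn by (simp add: w_def)
    have shift: "(\<Sum>j<n. (\<sigma> ^^ Suc i) (e j) * (\<sigma> (w j) - w j)) = 0" for i
    proof -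
      have "\<sigma> (\<Sum>j<Suc n. (\<sigma> ^^ i) (e j) * w j) = 0"
        using w s_0[of 1] by simp
      then have "(\<Sum>j<Suc n. (\<sigma> ^^ Suc i) (e j) * \<sigma> (w j)) = 0"
        unfolding sigma_sum sigma_mult sigma_s .
      then have "(\<Sum>j<Suc n. (\<sigma> ^^ Suc i) (e j) * (\<sigma> (w j) - w j)) = 0"
        unfolding right_diff_distrib sum_subtractf w by simp
      then show ?thesis
        using \<open>w n = 1\<close> s_1[of 1] by simp
    qed
    have "(\<Sum>j<n. (\<sigma> ^^ i) (e j) * (\<sigma> (w j) - w j)) = 0" for i
    proof -
      \<comment> \<open>Applying \<open>\<sigma>\<close> reaches only indices of the form
        \<open>Suc i\<close>; periodicity with period \<open>t\<close> recovers every index,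
        including 0.\<close>
      have "Suc (i + t - 1) = i + t"
        using t3 by simp
      then have "(\<sigma> ^^ Suc (i + t - 1)) x = (\<sigma> ^^ i) x" for x
        by (metis s_add_t)
      then show ?thesis
        using shift[of "i + t - 1"] by presburger
    qed
    then have "\<sigma> (w j) - w j = 0" if "j < n" for j
      using Suc.IH[OF indep, of "\<lambda>j. \<sigma> (w j) - w j"] that by blast
    then have "w j \<in> F" if "j < Suc n" for j
      using that fixed_imp_F[of 1 "w j"] not_dvd_less[of 1] t3 \<open>w n = 1\<close> by (cases "j = n") auto
    moreover have "(\<Sum>j<Suc n. w j * e j) = 0"
      using w[of 0] by (simp add: mult.commute)
    ultimately have "w n = 0"
      using indepD[OF Suc.prems(1), of w n] by simp
    then show False
      using \<open>w n = 1\<close> by simp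
  qed
  moreover from this have "(\<Sum>j<n. (\<sigma> ^^ i) (e j) * v j) = 0" for i
    using Suc.prems(2)[of i] by simp
  ultimately show ?case
    using Suc.IH[OF indep] Suc.prems(3) less_Suc_eq by blast
qed simp

text \<open>The extensional function space makes coefficient families finite in number, so spans can
  be compared by cardinality.\<close>

definition F_span :: "(nat \<Rightarrow> 'a) \<Rightarrow> nat \<Rightarrow> 'a set" where
  "F_span e n = (\<lambda>l. \<Sum>j<n. l j * e j) ` ({..<n} \<rightarrow>\<^sub>E F)"

lemma F_spanI: "(\<And>j. j < n \<Longrightarrow> l j \<in> F) \<Longrightarrow> (\<Sum>j<n. l j * e j) \<in> F_span e n"
  unfolding F_span_def
  by (rule image_eqI[of _ _ "restrict l {..<n}"]) (simp, simp add: restrict_PiE_iff)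

lemma card_F_span:
  assumes "indep e n"
  shows "card (F_span e n) = q ^ n"
proof -
  have "inj_on (\<lambda>l. \<Sum>j<n. l j * e j) ({..<n} \<rightarrow>\<^sub>E F)"
  proof (rule inj_onI)
    fix l m assume lm: "l \<in> {..<n} \<rightarrow>\<^sub>E F" "m \<in> {..<n} \<rightarrow>\<^sub>E F" "(\<Sum>j<n. l j * e j) = (\<Sum>j<n. m j * e j)"
    have "(\<Sum>j<n. (l j - m j) * e j) = 0"
      using lm(3) by (simp add: left_diff_distrib sum_subtractf)
    moreover have "l j - m j \<in> F" if "j < n" for j
      using PiE_mem[OF lm(1)] PiE_mem[OF lm(2)] that by (simp add: F_minus)
    ultimately have "l j - m j = 0" if "j < n" for j
      using indepD[OF assms _ _ that, of "\<lambda>j. l j - m j"] by simp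
    then show "l = m"
      by (intro PiE_ext[OF lm(1,2)]) simp
  qed
  then have "card (F_span e n) = card ({..<n} \<rightarrow>\<^sub>E F)"
    unfolding F_span_def by (rule card_image)
  also have "\<dots> = q ^ n"
    by (simp add: card_PiE card_F)
  finally show ?thesis .
qed

lemma F_span_UNIV:
  assumes "indep e t"
  shows "F_span e t = UNIV"
  by (rule card_subset_eq) (use card_F_span[OF assms] card_UNIV in auto)

text \<open>As long as \<open>n < t\<close>, the span has \<open>q ^ n < q ^ t\<close> elements, so
  a new independent element exists outside it. The induction runs downwards from
  \<open>t\<close>.\<close>

lemma indep_extend:
  assumes "n \<le> t" "indep e n"
  shows "\<exists>e'. indep e' t \<and> (\<forall>j<n. e' j = e j)"
  using assms
proof (induction n arbitrary: e rule: inc_induct)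
  case base
  then show ?case
    by (intro exI[of _ e]) simp
next
  case (step n)
  have "card (F_span e n) < card (UNIV :: 'a set)"
    unfolding card_F_span[OF step.prems] card_UNIV
    by (rule power_strict_increasing) (use step.hyps q1 in auto)
  then have "F_span e n \<noteq> UNIV"
    by force
  then obtain x where x: "x \<notin> F_span e n"
    by blast
  have "indep (e(n := x)) (Suc n)"
    unfolding indep_def
  proof (intro allI impI)
    fix l j assume l: "\<forall>j<Suc n. l j \<in> F" "(\<Sum>j<Suc n. l j * (e(n := x)) j) = 0" "j < Suc n"
    have sum: "(\<Sum>j<n. l j * e j) + l n * x = 0"
      using l(2) by simp
    have "l n = 0"
    proof (rule ccontr)
      assume ln: "l n \<noteq> 0"
      have "x = (\<Sum>j<n. (- l j / l n) * e j)"
      proof -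
        have "x = - (\<Sum>j<n. l j * e j) / l n"
        proof -
          have "l n * x = - (\<Sum>j<n. l j * e j)"
            using sum by (simp add: eq_neg_iff_add_eq_0 add.commute)
          then show ?thesis
            using ln by (metis nonzero_mult_div_cancel_left)
        qed
        also have "\<dots> = (\<Sum>j<n. (- l j / l n) * e j)"
          by (simp add: sum_negf sum_divide_distrib)
        finally show ?thesis .
      qed
      moreover have "- l j / l n \<in> F" if "j < n" for j
        using l(1) that by (intro F_divide F_uminus) auto
      ultimately show False
        using x F_spanI[of n "\<lambda>j. - l j / l n" e] by simp
    qed
    with sum have "l j = 0" if "j < n"
      using indepD[OF step.prems _ _ that, of l] l(1) by simp
    then show "l j = 0"
      using \<open>l n = 0\<close> l(3) by (cases "j = n") auto
  qed
  from step.IH[OF this] obtain e' where "indep e' t" "\<forall>j<Suc n. e' j = (e(n := x)) j"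
    by (elim exE conjE)
  then show ?case
    by (intro exI[of _ e']) simp
qed

definition V :: "'a \<Rightarrow> 'a vec" where
  "V l = vec t (\<lambda>i. (\<sigma> ^^ i) l)"

lemma subgeom_eq: "subgeom q t \<nu> = {pt (V l) | l. l \<noteq> 0}"
  unfolding subgeom_def V_def unfolding sigma_def ..

lemma V_eq_0: "V l = 0\<^sub>v t \<longleftrightarrow> l = 0"
proof
  assume "V l = 0\<^sub>v t"
  then have "V l $ 0 = 0\<^sub>v t $ 0"
    by simp
  then show "l = 0"
    using t3 by (simp add: V_def)
qed (auto simp: V_def)

text \<open>Column \<open>j\<close> is \<open>V (e j)\<close>. On vectors over \<open>F\<close> the
  matrix therefore acts as coordinates followed by \<open>V\<close>, and a basis \<open>e\<close>
  reaches every field element; invertibility is \<open>moore_injective\<close>.\<close>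

lemma moore_mat:
  assumes e: "indep e t"
  defines "A \<equiv> mat t t (\<lambda>(i, j). (\<sigma> ^^ i) (e j))"
  shows "projectivity_mat t A" "mat_image A (PG_points (Fq q) t) = subgeom q t \<nu>"
proof -
  have A: "A \<in> carrier_mat t t"
    by (simp add: A_def)
  have idx: "(A *\<^sub>v v) $ i = (\<Sum>j<t. (\<sigma> ^^ i) (e j) * v $ j)" if "i < t" "v \<in> carrier_vec t" for i v
    unfolding A_def using mat_mult_vec_index[OF that] by simp
  show proj: "projectivity_mat t A"
  proof (rule invertible_matI[OF A])
    fix v assume v: "v \<in> carrier_vec t" "A *\<^sub>v v = 0\<^sub>v t"
    \<comment> \<open>The matrix has rows only for \<open>i < t\<close>, but
      \<open>moore_injective\<close> asks for all \<open>i\<close>; reduction modulo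
      \<open>t\<close> closes the gap.\<close>
    have *: "(\<Sum>j<t. (\<sigma> ^^ i) (e j) * v $ j) = 0" for i
    proof -
      have "(\<Sum>j<t. (\<sigma> ^^ (i mod t)) (e j) * v $ j) = 0"
        using idx[of "i mod t" v] v t3 by simp
      then show ?thesis
        by (simp only: s_mod)
    qed
    have "v $ j = 0" if "j < t" for j
      by (rule moore_injective[OF e * that])
    then show "v = 0\<^sub>v t"
      using v by (intro eq_vecI) auto
  qed
  have AV: "A *\<^sub>v v = V (\<Sum>j<t. v $ j * e j)" if "v \<in> carrier_vec t" "\<forall>i<t. v $ i \<in> F" for v
  proof (rule eq_vecI)
    fix i assume "i < dim_vec (V (\<Sum>j<t. v $ j * e j))"
    then have i: "i < t"
      by (simp add: V_def)
    have "V (\<Sum>j<t. v $ j * e j) $ i = (\<Sum>j<t. (\<sigma> ^^ i) (v $ j * e j))"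
      using i by (simp add: V_def s_sum)
    also have "\<dots> = (\<Sum>j<t. (\<sigma> ^^ i) (e j) * v $ j)"
      using that by (intro sum.cong) (auto simp: s_F)
    finally show "(A *\<^sub>v v) $ i = V (\<Sum>j<t. v $ j * e j) $ i"
      using idx i that by simp
  qed (use A in \<open>simp add: V_def\<close>)
  show "mat_image A (PG_points (Fq q) t) = subgeom q t \<nu>"
  proof (intro equalityI subsetI)
    fix P assume "P \<in> mat_image A (PG_points (Fq q) t)"
    then obtain v where v: "v \<in> carrier_vec t" "v \<noteq> 0\<^sub>v t" "\<forall>i<t. v $ i \<in> F"
      and P: "P = (\<lambda>v. A *\<^sub>v v) ` pt v"
      unfolding mat_image_def PG_points_def F_def by blast
    have "A *\<^sub>v v \<noteq> 0\<^sub>v t"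
      using projectivity_mat_inj[OF proj v(1)] v(2) by blast
    then have "(\<Sum>j<t. v $ j * e j) \<noteq> 0"
      using AV v V_eq_0 by auto
    then show "P \<in> subgeom q t \<nu>"
      unfolding P pt_image[OF A v(1)] subgeom_eq AV[OF v(1,3)] by blast
  next
    fix P :: "'a vec set" assume "P \<in> subgeom q t \<nu>"
    then obtain l where l: "l \<noteq> 0" "P = pt (V l)"
      by (auto simp: subgeom_eq)
    have "l \<in> F_span e t"
      using F_span_UNIV[OF e] by simp
    then obtain m where m: "m \<in> {..<t} \<rightarrow>\<^sub>E F" "l = (\<Sum>j<t. m j * e j)"
      unfolding F_span_def by (elim imageE)
    have F: "\<forall>i<t. vec t m $ i \<in> F"
      using m(1) by auto
    have "l = (\<Sum>j<t. vec t m $ j * e j)"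
      using m(2) by simp
    then have AV': "A *\<^sub>v vec t m = V l"
      using AV[OF _ F] by simp
    have "vec t m \<noteq> 0\<^sub>v t"
    proof
      assume "vec t m = 0\<^sub>v t"
      then have "V l = A *\<^sub>v 0\<^sub>v t"
        using AV' by simp
      also have "\<dots> = 0\<^sub>v t"
        using A by auto
      finally show False
        using l(1) V_eq_0 by blast
    qed
    then have "pt (vec t m) \<in> PG_points (Fq q) t"
      using F unfolding PG_points_def F_def by (intro CollectI exI[of _ "vec t m"]) simp
    then have "(\<lambda>v. A *\<^sub>v v) ` pt (vec t m) \<in> mat_image A (PG_points (Fq q) t)"
      unfolding mat_image_def by (rule imageI)
    then show "P \<in> mat_image A (PG_points (Fq q) t)"
      using pt_image[OF A, of "vec t m"] l(2) AV' by simp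
  qed
qed

text \<open>Independence of a pair over \<open>F\<close>, put as a condition on the ratio:
  proportional conjugates then mean that a power map fixes \<open>a / c\<close>.\<close>

definition indep2 :: "'a \<Rightarrow> 'a \<Rightarrow> bool" where
  "indep2 a c \<longleftrightarrow> c \<noteq> 0 \<and> a / c \<notin> F"

lemma indep2_nz: "indep2 a c \<Longrightarrow> a \<noteq> 0 \<and> c \<noteq> 0"
  by (auto simp: indep2_def)

lemma indep2_fixed_pow:
  assumes "indep2 a c" "\<not> t dvd m"
  shows "a * c ^ (q ^ m) \<noteq> a ^ (q ^ m) * c"
proof
  assume "a * c ^ (q ^ m) = a ^ (q ^ m) * c"
  then have "(a / c) ^ (q ^ m) = a / c"
    using assms(1) by (simp add: indep2_def power_divide divide_eq_eq eq_divide_eq mult.commute)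
  then show False
    using fixed_pow_imp_F assms by (auto simp: indep2_def)
qed

text \<open>Conjugate linear forms \<open>x * (\<sigma> ^^ i) a + y * (\<sigma> ^^ i) c\<close> with
  different indices modulo \<open>t\<close> are independent: after cancelling
  \<open>\<sigma> ^^ i\<close>, a dependence would put \<open>a / c\<close> into
  \<open>F\<close>.\<close>

lemma indep2_s:
  assumes "indep2 a c" "\<not> t dvd m"
  shows "(\<sigma> ^^ i) a * (\<sigma> ^^ (i + m)) c \<noteq> (\<sigma> ^^ (i + m)) a * (\<sigma> ^^ i) c"
proof
  assume "(\<sigma> ^^ i) a * (\<sigma> ^^ (i + m)) c = (\<sigma> ^^ (i + m)) a * (\<sigma> ^^ i) c"
  then have "(\<sigma> ^^ i) (a * (\<sigma> ^^ m) c - (\<sigma> ^^ m) a * c) = 0"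
    by (simp add: s_s)
  then have "a * (\<sigma> ^^ m) c = (\<sigma> ^^ m) a * c"
    unfolding s_eq_0_iff by simp
  moreover have "\<not> t dvd \<nu> * m"
    using assms(2) not_dvd_nu t_prime by (simp add: prime_dvd_mult_iff)
  ultimately show False
    using indep2_fixed_pow[OF assms(1)] by (simp add: sigma_funpow)
qed

lemma s_coeff_prod:
  fixes n :: nat
  shows "(\<sigma> ^^ i) (poly.coeff (\<Prod>k<n. [:f k, g k:]) j) =
    poly.coeff (\<Prod>k<n. [:(\<sigma> ^^ i) (f k), (\<sigma> ^^ i) (g k):]) j"
proof (induction n arbitrary: j)
  case 0
  then show ?case
    by (cases j) auto
next
  case (Suc n)
  show ?case
    unfolding prod.lessThan_Suc mult.commute[of "prod _ _"] coeff_linear_mult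
    by (cases j) (auto simp: Suc)
qed

text \<open>Row \<open>i\<close> holds the coefficients of the \<open>i\<close>-th conjugate of one
  product of \<open>n\<close> linear forms, so applying it to powers of \<open>y\<close> evaluates
  that product. The formula holds for every \<open>y\<close> in the big field: restricted to
  \<open>F\<close> it gives curves inside \<open>\<Sigma>\<close>, unrestricted a normal rational
  curve of the whole space.\<close>

lemma nrc_matrix:
  assumes ac: "indep2 a c" and n: "n < t"
  obtains A where "projectivity_mat t A" "mat_image A (PG_points (Fq q) t) = subgeom q t \<nu>"
    "\<forall>y. A *\<^sub>v vec t (\<lambda>j. if j \<le> n then y ^ j else 0) =
      vec t (\<lambda>i. \<Prod>k<n. (\<sigma> ^^ (i + k)) a + y * (\<sigma> ^^ (i + k)) c)"
    "A *\<^sub>v unit_vec t n = vec t (\<lambda>i. \<Prod>k<n. (\<sigma> ^^ (i + k)) c)"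
proof -
  define G where "G i = (\<Prod>k<n. [:(\<sigma> ^^ (i + k)) a, (\<sigma> ^^ (i + k)) c:])" for i
  define e where "e = poly.coeff (G 0)"
  have s_e: "(\<sigma> ^^ i) (e j) = poly.coeff (G i) j" for i j
    unfolding e_def G_def s_coeff_prod by (simp add: s_s)
  have deg: "degree (G i) \<le> n" and lead: "poly.coeff (G i) n = (\<Prod>k<n. (\<sigma> ^^ (i + k)) c)" for i
    unfolding G_def
    using prod_linear_degree_coeff[of "{..<n}" "\<lambda>k. (\<sigma> ^^ (i + k)) a" "\<lambda>k. (\<sigma> ^^ (i + k)) c"]
    by simp_all
  have "indep e (Suc n)"
    unfolding indep_def
  proof (intro allI impI)
    fix l j assume l: "\<forall>j<Suc n. l j \<in> F" "(\<Sum>j<Suc n. l j * e j) = 0" and j: "j < Suc n"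
    \<comment> \<open>Since the \<open>l j\<close> are fixed by \<open>\<sigma>\<close>, one
      relation becomes a functional that vanishes on every window \<open>G i\<close>.\<close>
    have *: "(\<Sum>j\<le>n. l j * poly.coeff (G i) j) = 0" for i
    proof -
      have "0 = (\<sigma> ^^ i) (\<Sum>j<Suc n. l j * e j)"
        by (simp only: l(2) s_0)
      also have "\<dots> = (\<Sum>j<Suc n. l j * poly.coeff (G i) j)"
        unfolding s_sum s_mult s_e using l(1) by (intro sum.cong) (auto simp: s_F)
      finally show ?thesis
        by (simp only: lessThan_Suc_atMost)
    qed
    show "l j = 0"
    proof (rule functional_windows_eq_0[of n "\<lambda>i. (\<sigma> ^^ i) a" "\<lambda>i. (\<sigma> ^^ i) c"])
      show "(\<sigma> ^^ i) a * (\<sigma> ^^ (i + m)) c \<noteq> (\<sigma> ^^ (i + m)) a * (\<sigma> ^^ i) c" if "0 < m" "m \<le> n" for i m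
        using indep2_s[OF ac not_dvd_less] that n by simp
    qed (use * j in \<open>auto simp: G_def\<close>)
  qed
  \<comment> \<open>The columns after \<open>n\<close> may be any completion to a basis, as the
    vectors of the curve are zero there.\<close>
  from indep_extend[OF Suc_leI[OF n] this]
  obtain e' where e': "indep e' t" "\<forall>j<Suc n. e' j = e j"
    by (elim exE conjE)
  define A where "A = mat t t (\<lambda>(i, j). (\<sigma> ^^ i) (e' j))"
  have idx: "(A *\<^sub>v v) $ i = (\<Sum>j<t. (\<sigma> ^^ i) (e' j) * v $ j)" if "i < t" "v \<in> carrier_vec t" for i v
    unfolding A_def using mat_mult_vec_index[OF that] by simp
  have "A *\<^sub>v vec t (\<lambda>j. if j \<le> n then y ^ j else 0) =
      vec t (\<lambda>i. \<Prod>k<n. (\<sigma> ^^ (i + k)) a + y * (\<sigma> ^^ (i + k)) c)" for y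
  proof (rule eq_vecI)
    fix i assume "i < dim_vec (vec t (\<lambda>i. \<Prod>k<n. (\<sigma> ^^ (i + k)) a + y * (\<sigma> ^^ (i + k)) c))"
    then have i: "i < t"
      by simp
    have "(A *\<^sub>v vec t (\<lambda>j. if j \<le> n then y ^ j else 0)) $ i =
        (\<Sum>j<t. (\<sigma> ^^ i) (e' j) * (if j \<le> n then y ^ j else 0))"
      using idx i by simp
    also have "\<dots> = (\<Sum>j\<le>n. poly.coeff (G i) j * y ^ j)"
      by (rule sum.mono_neutral_cong_right) (use n e'(2) s_e in auto)
    also have "\<dots> = poly (G i) y"
      using poly_eq_sum_atMost[OF deg] by simp
    also have "\<dots> = (\<Prod>k<n. (\<sigma> ^^ (i + k)) a + y * (\<sigma> ^^ (i + k)) c)"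
      by (simp add: G_def poly_prod)
    finally show "(A *\<^sub>v vec t (\<lambda>j. if j \<le> n then y ^ j else 0)) $ i =
      vec t (\<lambda>i. \<Prod>k<n. (\<sigma> ^^ (i + k)) a + y * (\<sigma> ^^ (i + k)) c) $ i"
      using i by simp
  qed (simp add: A_def)
  moreover have "A *\<^sub>v unit_vec t n = vec t (\<lambda>i. \<Prod>k<n. (\<sigma> ^^ (i + k)) c)"
  proof (rule eq_vecI)
    fix i assume "i < dim_vec (vec t (\<lambda>i. \<Prod>k<n. (\<sigma> ^^ (i + k)) c))"
    then have i: "i < t"
      by simp
    have "(A *\<^sub>v unit_vec t n) $ i = (\<Sum>j<t. (\<sigma> ^^ i) (e' j) * (if j = n then 1 else 0))"
      using idx i n by (auto simp: unit_vec_def intro!: sum.cong)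
    also have "\<dots> = (\<sigma> ^^ i) (e' n)"
      using n by (simp add: if_distrib cong: if_cong)
    finally show "(A *\<^sub>v unit_vec t n) $ i = vec t (\<lambda>i. \<Prod>k<n. (\<sigma> ^^ (i + k)) c) $ i"
      using i e'(2) s_e lead by simp
  qed (simp add: A_def)
  ultimately show thesis
    using that[OF moore_mat[OF e'(1), folded A_def]] by simp
qed

end

subsection \<open>Normal rational curves over sublines\<close>

lemma mat_image_std_nrc:
  assumes "A \<in> carrier_mat m m"
  shows "mat_image A (std_nrc K m n) =
    {pt (A *\<^sub>v vec m (\<lambda>i. if i \<le> n then y ^ i else 0)) | y. y \<in> K} \<union> {pt (A *\<^sub>v unit_vec m n)}"
proof -
  have "(\<lambda>v. A *\<^sub>v v) ` pt (vec m f) = pt (A *\<^sub>v vec m f)" for f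
    using assms by (rule pt_image) simp
  moreover have "(\<lambda>v. A *\<^sub>v v) ` pt (unit_vec m n) = pt (A *\<^sub>v unit_vec m n)"
    using assms by (rule pt_image) simp
  ultimately show ?thesis
    unfolding mat_image_def std_nrc_def image_Un setcompr_eq_image image_image by simp
qed

section \<open>The projection from \<open>Gam t\<close> and its effect on the subgeometry\<close>

lemma proj_pt:
  fixes x :: "'a::field vec"
  assumes x: "x \<in> carrier_vec t" and t: "2 \<le> t"
  shows "proj t (pt x) = line0_pt t (x $ (t - 2)) (x $ (t - 1))"
proof -
  define y where "y = vec t (\<lambda>i. if i = t - 2 then x $ (t - 2) else if i = t - 1 then x $ (t - 1) else 0)"
  have ne: "t - 1 \<noteq> t - 2"
    using t by simp
  have "proj t (pt x) = pt y"
  proof (intro equalityI subsetI)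
    fix z assume "z \<in> proj t (pt x)"
    then obtain u c where u: "u \<in> Gam t" "z = u + c \<cdot>\<^sub>v x" and z: "z \<in> line0 t"
      unfolding proj_def join_def pt_def by blast
    have "z = c \<cdot>\<^sub>v y"
    proof (rule eq_vecI)
      show "dim_vec z = dim_vec (c \<cdot>\<^sub>v y)"
        using z by (simp add: line0_def y_def)
      fix i assume "i < dim_vec (c \<cdot>\<^sub>v y)"
      then have i: "i < t"
        by (simp add: y_def)
      show "z $ i = (c \<cdot>\<^sub>v y) $ i"
      proof (cases "i < t - 2")
        case True
        then show ?thesis
          using z i ne by (auto simp: line0_def y_def)
      next
        case False
        then have "i = t - 2 \<or> i = t - 1"
          using i by linarith
        then show ?thesis
          using u x i ne by (auto simp: Gam_def y_def)
      qed
    qed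
    then show "z \<in> pt y"
      unfolding pt_def by blast
  next
    fix z assume "z \<in> pt y"
    then obtain c where c: "z = c \<cdot>\<^sub>v y"
      unfolding pt_def by blast
    have "c \<cdot>\<^sub>v y - c \<cdot>\<^sub>v x \<in> Gam t"
      using x t ne by (auto simp: Gam_def y_def)
    moreover have "z = (c \<cdot>\<^sub>v y - c \<cdot>\<^sub>v x) + c \<cdot>\<^sub>v x"
      unfolding c using x by (intro eq_vecI) (auto simp: y_def)
    moreover have "z \<in> line0 t"
      unfolding c by (auto simp: line0_def y_def)
    ultimately show "z \<in> proj t (pt x)"
      unfolding proj_def join_def pt_def by blast
  qed
  then show ?thesis
    unfolding line0_pt_def y_def .
qed

context field_ext
begin

lemma V_carrier [simp]: "V l \<in> carrier_vec t"
  by (simp add: V_def)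

lemma V_smult: "x \<in> F \<Longrightarrow> V (x * l) = x \<cdot>\<^sub>v V l"
  unfolding V_def by (rule eq_vecI) (auto simp: s_F)

lemma pt_V_smult: "x \<in> F \<Longrightarrow> x \<noteq> 0 \<Longrightarrow> pt (V (x * l)) = pt (V l)"
  by (simp add: V_smult pt_smult)

text \<open>Coordinate 0 yields the factor \<open>c\<close>; coordinate 1 yields
  \<open>\<sigma> c = c\<close>, so the factor lies in \<open>F\<close>.\<close>

lemma pt_V_eqD:
  assumes "pt (V l) = pt (V m)" "l \<noteq> 0"
  obtains x where "x \<in> F" "x \<noteq> 0" "l = x * m"
proof -
  obtain c where c: "c \<noteq> 0" "\<And>i. i < t \<Longrightarrow> (\<sigma> ^^ i) l = c * (\<sigma> ^^ i) m"
    using pt_vec_eqD[OF assms(1)[unfolded V_def], of 0] assms(2) t3 by auto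
  have lm: "l = c * m"
    using c(2)[of 0] t3 by simp
  have "(\<sigma> ^^ 1) c * (\<sigma> ^^ 1) m = (\<sigma> ^^ 1) l"
    unfolding lm s_mult ..
  also have "\<dots> = c * (\<sigma> ^^ 1) m"
    by (rule c(2)) (use t3 in simp)
  finally have "(\<sigma> ^^ 1) c = c"
    unfolding mult_cancel_right s_eq_0_iff using lm assms(2) by auto
  then have "c \<in> F"
    by (rule fixed_imp_F) (use not_dvd_less[of 1] t3 in simp)
  then show thesis
    using that c(1) lm by blast
qed

lemma proj_V: "proj t (pt (V l)) = line0_pt t ((\<sigma> ^^ (t - 2)) l) ((\<sigma> ^^ (t - 1)) l)"
  using proj_pt[of "V l" t] t3 by (simp add: V_def)

text \<open>The exponents \<open>t - 2\<close> and \<open>t - 1\<close> of the surviving coordinates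
  become 0 and 1 modulo \<open>t\<close> once \<open>\<sigma> ^^ 2\<close> is applied first.\<close>

lemma s_t2: "(\<sigma> ^^ (t - 2)) ((\<sigma> ^^ 2) x) = x" and s_t1: "(\<sigma> ^^ (t - 1)) ((\<sigma> ^^ 2) x) = \<sigma> x"
  and s_2t2: "(\<sigma> ^^ 2) ((\<sigma> ^^ (t - 2)) x) = x"
proof -
  have *: "t - 2 + 2 = t" "2 + (t - 2) = t" "t - 1 + 2 = 1 + t"
    using t3 by auto
  show "(\<sigma> ^^ (t - 2)) ((\<sigma> ^^ 2) x) = x" "(\<sigma> ^^ 2) ((\<sigma> ^^ (t - 2)) x) = x"
    unfolding s_s * by simp_all
  show "(\<sigma> ^^ (t - 1)) ((\<sigma> ^^ 2) x) = \<sigma> x"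
    unfolding s_s * s_add_t by simp
qed

lemma proj_V_shift: "proj t (pt (V ((\<sigma> ^^ 2) l))) = line0_pt t l (\<sigma> l)"
  unfolding proj_V s_t2 s_t1 ..

lemma proj_subgeom: "proj t ` subgeom q t \<nu> = (lin_set q t \<nu> :: 'a vec set set)"
proof -
  have "lin_set q t \<nu> = {line0_pt t m (\<sigma> m) | m. m \<noteq> 0}"
    unfolding lin_set_def sigma_def ..
  moreover have "subgeom q t \<nu> = {pt (V ((\<sigma> ^^ 2) m)) | m. m \<noteq> 0}"
  proof -
    have "{V l | l. l \<noteq> 0} = {V ((\<sigma> ^^ 2) m) | m. m \<noteq> 0}"
    proof (intro equalityI subsetI)
      fix v assume "v \<in> {V l | l. l \<noteq> 0}"
      then obtain l where "v = V l" "l \<noteq> 0"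
        by blast
      then have "v = V ((\<sigma> ^^ 2) ((\<sigma> ^^ (t - 2)) l))" "(\<sigma> ^^ (t - 2)) l \<noteq> 0"
        unfolding s_2t2 s_eq_0_iff by simp_all
      then show "v \<in> {V ((\<sigma> ^^ 2) m) | m. m \<noteq> 0}"
        by blast
    next
      fix v assume "v \<in> {V ((\<sigma> ^^ 2) m) | m. m \<noteq> 0}"
      then obtain m where "v = V ((\<sigma> ^^ 2) m)" "m \<noteq> 0"
        by blast
      moreover have "(\<sigma> ^^ 2) m \<noteq> 0"
        using \<open>m \<noteq> 0\<close> unfolding s_eq_0_iff .
      ultimately show "v \<in> {V l | l. l \<noteq> 0}"
        by blast
    qed
    moreover have "{pt (V l) | l. l \<noteq> 0} = pt ` {V l | l. l \<noteq> 0}"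
      "{pt (V ((\<sigma> ^^ 2) m)) | m. m \<noteq> 0} = pt ` {V ((\<sigma> ^^ 2) m) | m. m \<noteq> 0}"
      by blast+
    ultimately show ?thesis
      unfolding subgeom_eq by metis
  qed
  ultimately show ?thesis
    using proj_V_shift by (auto simp: image_iff; metis)
qed

text \<open>The two surviving coordinates are consecutive conjugates. Applying
  \<open>\<sigma>\<close> to the equation for the first and comparing with the second forces the
  factor into \<open>F\<close>. This lets a preimage in \<open>\<Sigma>\<close> be read off from its
  projection.\<close>

lemma inj_on_proj: "inj_on (proj t) (subgeom q t \<nu> :: 'a vec set set)"
proof (rule inj_onI)
  fix P Q :: "'a vec set"
  assume "P \<in> subgeom q t \<nu>" "Q \<in> subgeom q t \<nu>" and eq: "proj t P = proj t Q"
  then obtain l m where l: "l \<noteq> 0" "P = pt (V l)" and m: "m \<noteq> 0" "Q = pt (V m)"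
    unfolding subgeom_eq by blast
  have "((\<sigma> ^^ (t - 2)) l, (\<sigma> ^^ (t - 1)) l) \<noteq> (0, 0)"
    using l(1) by simp
  from line0_pt_eqD[OF eq[unfolded l m proj_V] this]
  obtain c where c: "c \<noteq> 0" "(\<sigma> ^^ (t - 2)) l = c * (\<sigma> ^^ (t - 2)) m"
      "(\<sigma> ^^ (t - 1)) l = c * (\<sigma> ^^ (t - 1)) m"
    using t3 by (metis One_nat_def Suc_1 Suc_leD numeral_3_eq_3)
  have "t - 1 = Suc (t - 2)"
    using t3 by simp
  then have "(\<sigma> ^^ (t - 1)) l = \<sigma> c * (\<sigma> ^^ (t - 1)) m"
    using arg_cong[OF c(2), of \<sigma>] by (simp add: sigma_mult)
  then have "\<sigma> c = c"
    using c(3) m(1) s_eq_0_iff[of "t - 1" m] by simp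
  then have cF: "c \<in> F"
    using fixed_imp_F[of 1 c] not_dvd_less[of 1] t3 by simp
  then have "(\<sigma> ^^ (t - 2)) (l - c * m) = 0"
    using c(2) by (simp add: s_F)
  then have "l = c * m"
    unfolding s_eq_0_iff by simp
  then show "P = Q"
    using l m pt_V_smult[OF cF c(1)] by simp
qed

definition span2 :: "'a \<Rightarrow> 'a \<Rightarrow> 'a set" where
  "span2 a c = {x * a + y * c | x y. x \<in> F \<and> y \<in> F}"

lemma span2I: "x \<in> F \<Longrightarrow> y \<in> F \<Longrightarrow> x * a + y * c \<in> span2 a c"
  unfolding span2_def by blast

lemma span2_gen: "a \<in> span2 a c" "c \<in> span2 a c"
  using span2I[of 1 0 a c] span2I[of 0 1 a c] by simp_all

lemma indep2_comb_eq_0: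
  assumes "indep2 a c" "x \<in> F" "y \<in> F"
  shows "x * a + y * c = 0 \<longleftrightarrow> x = 0 \<and> y = 0"
proof
  assume eq: "x * a + y * c = 0"
  have c: "c \<noteq> 0"
    using assms(1) indep2_nz by blast
  have "x = 0"
  proof (rule ccontr)
    assume x: "x \<noteq> 0"
    have "x * a = (- y) * c"
      using eq by (simp add: eq_neg_iff_add_eq_0)
    then have "x * a / x = (- y) * c / x"
      by simp
    then have "a = (- y / x) * c"
      using x by simp
    then have "a / c = - y / x"
      using c by (metis nonzero_mult_div_cancel_right)
    then show False
      using assms F_divide[OF F_uminus] by (simp add: indep2_def)
  qed
  then show "x = 0 \<and> y = 0"
    using eq c by simp
qed simp

lemma span2_mult: "span2 (m * a) (m * c) = (\<lambda>w. m * w) ` span2 a c"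
proof -
  have "x * (m * a) + y * (m * c) = m * (x * a + y * c)" for x y
    by (simp add: algebra_simps)
  then show ?thesis
    unfolding span2_def by (simp only:) blast
qed

lemma span2_s: "span2 ((\<sigma> ^^ i) a) ((\<sigma> ^^ i) c) = (\<sigma> ^^ i) ` span2 a c"
proof -
  have "(\<sigma> ^^ i) (x * a + y * c) = x * (\<sigma> ^^ i) a + y * (\<sigma> ^^ i) c" if "x \<in> F" "y \<in> F" for x y
    using that by (simp add: s_F)
  then have "{x * (\<sigma> ^^ i) a + y * (\<sigma> ^^ i) c | x y. x \<in> F \<and> y \<in> F} =
      {(\<sigma> ^^ i) (x * a + y * c) | x y. x \<in> F \<and> y \<in> F}"
    by (intro Collect_cong iff_exI) auto
  then show ?thesis
    unfolding span2_def by blast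
qed

lemma indep2_mult: "indep2 a c \<Longrightarrow> m \<noteq> 0 \<Longrightarrow> indep2 (m * a) (m * c)"
  by (simp add: indep2_def)

lemma indep2_s_s:
  assumes "indep2 a c"
  shows "indep2 ((\<sigma> ^^ i) a) ((\<sigma> ^^ i) c)"
proof -
  have "a / c \<in> F" if "(\<sigma> ^^ i) a / (\<sigma> ^^ i) c \<in> F"
  proof -
    have "(\<sigma> ^^ i) (a / c) \<in> F"
      using that by simp
    then have "(\<sigma> ^^ 1) ((\<sigma> ^^ i) (a / c)) = (\<sigma> ^^ i) (a / c)"
      by (rule s_F)
    then have "(\<sigma> ^^ i) ((\<sigma> ^^ 1) (a / c) - a / c) = 0"
      unfolding s_diff right_minus_eq s_s by (simp only: add.commute)
    then have "(\<sigma> ^^ 1) (a / c) = a / c"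
      unfolding s_eq_0_iff by simp
    then show ?thesis
      by (rule fixed_imp_F) (use not_dvd_less[of 1] t3 in simp)
  qed
  then show ?thesis
    using assms unfolding indep2_def by auto
qed

definition Q :: "nat \<Rightarrow> 'a \<Rightarrow> 'a" where
  "Q n w = (\<Prod>k<n. (\<sigma> ^^ k) w)"

lemma Q_smult: "x \<in> F \<Longrightarrow> Q n (x * w) = x ^ n * Q n w"
  by (simp add: Q_def s_F prod.distrib)

lemma Q_s: "Q n ((\<sigma> ^^ i) w) = (\<sigma> ^^ i) (Q n w)"
  by (simp add: Q_def s_prod s_s add.commute)

lemma Q_nz: "w \<noteq> 0 \<Longrightarrow> Q n w \<noteq> 0"
  by (simp add: Q_def)

text \<open>Telescoping: both sides are the product of the first \<open>n + 1\<close> conjugates. So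
  \<open>(Q n w, \<sigma> (Q n w))\<close> is proportional to \<open>(w, (\<sigma> ^^ n) w)\<close>
  for nonzero \<open>w\<close>.\<close>

lemma sigma_Q: "\<sigma> (Q n w) * w = Q n w * (\<sigma> ^^ n) w"
proof -
  have "\<sigma> (Q n w) = (\<Prod>k<n. (\<sigma> ^^ Suc k) w)"
    using s_prod[of 1] by (simp add: Q_def)
  then have "\<sigma> (Q n w) * w = (\<Prod>k<Suc n. (\<sigma> ^^ k) w)"
    by (subst prod.lessThan_Suc_shift) simp
  then show ?thesis
    by (simp add: Q_def)
qed

lemma V_Q: "V (Q n w) = vec t (\<lambda>i. \<Prod>k<n. (\<sigma> ^^ (i + k)) w)"
  by (simp add: V_def Q_def s_prod s_s)

lemma F_power: "x \<in> F \<Longrightarrow> x ^ n \<in> F"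
  by (induction n) (auto intro: F_mult)

definition curve :: "nat \<Rightarrow> 'a \<Rightarrow> 'a \<Rightarrow> 'a vec set set" where
  "curve n a c = (\<lambda>w. pt (V (Q n w))) ` (span2 a c - {0})"

lemma is_nrc_in_curve:
  assumes ac: "indep2 a c" and n: "n < t"
  shows "is_nrc_in q t (subgeom q t \<nu>) n (curve n a c)"
proof -
  obtain A where A: "projectivity_mat t A" "mat_image A (PG_points (Fq q) t) = subgeom q t \<nu>"
    and Ay: "\<forall>y. A *\<^sub>v vec t (\<lambda>j. if j \<le> n then y ^ j else 0) =
      vec t (\<lambda>i. \<Prod>k<n. (\<sigma> ^^ (i + k)) a + y * (\<sigma> ^^ (i + k)) c)"
    and Au: "A *\<^sub>v unit_vec t n = vec t (\<lambda>i. \<Prod>k<n. (\<sigma> ^^ (i + k)) c)"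
    by (rule nrc_matrix[OF assms])
  have carrier: "A \<in> carrier_mat t t"
    using A(1) by (simp add: projectivity_mat_def)
  have "A *\<^sub>v vec t (\<lambda>j. if j \<le> n then y ^ j else 0) = V (Q n (a + y * c))" if "y \<in> F" for y
    unfolding Ay[rule_format] V_Q using that by (simp add: s_F)
  then have "mat_image A (std_nrc F t n) =
      {pt (V (Q n (a + y * c))) | y. y \<in> F} \<union> {pt (V (Q n c))}"
    unfolding mat_image_std_nrc[OF carrier] Au V_Q[symmetric] setcompr_eq_image by simp
  also have "\<dots> = curve n a c"
  proof (intro equalityI subsetI)
    fix P assume "P \<in> {pt (V (Q n (a + y * c))) | y. y \<in> F} \<union> {pt (V (Q n c))}"
    then consider y where "y \<in> F" "P = pt (V (Q n (a + y * c)))" | "P = pt (V (Q n c))"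
      by blast
    then show "P \<in> curve n a c"
    proof cases
      case 1
      then show ?thesis
        unfolding curve_def
        using span2I[of 1 y a c] indep2_comb_eq_0[OF ac, of 1 y]
        by (intro image_eqI[of _ _ "a + y * c"]) auto
    next
      case 2
      then show ?thesis
        unfolding curve_def using span2_gen indep2_nz[OF ac] by blast
    qed
  next
    fix P assume "P \<in> curve n a c"
    then obtain x y where xy: "x \<in> F" "y \<in> F" "x * a + y * c \<noteq> 0"
      and P: "P = pt (V (Q n (x * a + y * c)))"
      unfolding curve_def span2_def by blast
    show "P \<in> {pt (V (Q n (a + y * c))) | y. y \<in> F} \<union> {pt (V (Q n c))}"
    proof (cases "x = 0")
      case True
      then have "P = pt (V (Q n c))"
        using P xy by (simp add: Q_smult pt_V_smult F_power)
      then show ?thesis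
        by blast
    next
      case False
      \<comment> \<open>Scaling by \<open>x\<close> in \<open>F\<close> multiplies
        \<open>Q n\<close> by \<open>x ^ n\<close>, again in \<open>F\<close>, so the point is
        unchanged and \<open>x\<close> can be normalised to 1; \<open>x = 0\<close> is the parameter
        at infinity.\<close>
      have "x * a + y * c = x * (a + (y / x) * c)"
        using False by (simp add: distrib_left)
      then have "P = pt (V (Q n (a + (y / x) * c)))"
        using P xy False by (simp add: Q_smult pt_V_smult F_power)
      then show ?thesis
        using F_divide xy by blast
    qed
  qed
  finally show ?thesis
    using A unfolding is_nrc_in_def F_def by blast
qed

lemma pow_cong:
  fixes x :: 'a
  assumes "[m = m'] (mod t)"
  shows "x ^ (q ^ m) = x ^ (q ^ m')"
proof -
  have "(frob q 1 ^^ t) x = x"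
    unfolding frob_funpow using pow_qt[of x 1] by simp
  then have "(frob q 1 ^^ (m mod t)) x = (frob q 1 ^^ m) x" for m
    by (rule funpow_mod_eq)
  then show ?thesis
    using assms unfolding cong_def frob_funpow by (metis mult_1)
qed

section \<open>Sublines and lines of the field reduction\<close>

definition subline :: "nat \<Rightarrow> 'a \<Rightarrow> 'a \<Rightarrow> 'a vec set set" where
  "subline h a c = (\<lambda>w. line0_pt t w (w ^ (q ^ h))) ` (span2 a c - {0})"

lemma comb_pow: "x \<in> F \<Longrightarrow> y \<in> F \<Longrightarrow>
  (x * a + y * c) ^ (q ^ h) = x * a ^ (q ^ h) + y * c ^ (q ^ h)"
  by (simp add: pow_add power_mult_distrib F_pow)

text \<open>The power \<open>q ^ h\<close> is linear over \<open>F\<close>, so the points arise from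
  \<open>(x, y)\<close> by the matrix with rows \<open>(a, c)\<close> and their powers; its
  determinant is nonzero by \<open>indep2_fixed_pow\<close>.\<close>

lemma is_subline_subline:
  assumes "indep2 a c" "\<not> t dvd h"
  shows "is_subline q t (subline h a c)"
proof -
  have "a * c ^ (q ^ h) - c * a ^ (q ^ h) \<noteq> 0"
    using indep2_fixed_pow[OF assms] by (simp add: mult.commute)
  moreover have "subline h a c = {line0_pt t (a * x + c * y) (a ^ (q ^ h) * x + c ^ (q ^ h) * y) | x y.
      x \<in> Fq q \<and> y \<in> Fq q \<and> (x, y) \<noteq> (0, 0)}" (is "_ = ?R")
  proof (intro equalityI subsetI)
    fix P assume "P \<in> subline h a c"
    then obtain x y where "x \<in> F" "y \<in> F" "x * a + y * c \<noteq> 0"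
      and "P = line0_pt t (x * a + y * c) ((x * a + y * c) ^ (q ^ h))"
      unfolding subline_def span2_def by blast
    then have "P = line0_pt t (a * x + c * y) (a ^ (q ^ h) * x + c ^ (q ^ h) * y)"
      unfolding comb_pow[OF \<open>x \<in> F\<close> \<open>y \<in> F\<close>] by (simp only: mult.commute)
    moreover have "(x, y) \<noteq> (0, 0)"
      using \<open>x * a + y * c \<noteq> 0\<close> by auto
    ultimately show "P \<in> ?R"
      using \<open>x \<in> F\<close> \<open>y \<in> F\<close> unfolding F_def by blast
  next
    fix P assume "P \<in> ?R"
    then obtain x y where xy: "x \<in> F" "y \<in> F" "(x, y) \<noteq> (0, 0)"
      and P: "P = line0_pt t (a * x + c * y) (a ^ (q ^ h) * x + c ^ (q ^ h) * y)"
      unfolding F_def by blast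
    have "P = line0_pt t (x * a + y * c) ((x * a + y * c) ^ (q ^ h))"
      unfolding P comb_pow[OF xy(1,2)] by (simp only: mult.commute)
    moreover have "x * a + y * c \<noteq> 0"
      using indep2_comb_eq_0[OF assms(1) xy(1,2)] xy(3) by simp
    ultimately show "P \<in> subline h a c"
      unfolding subline_def using span2I[OF xy(1,2)] by blast
  qed
  ultimately show ?thesis
    unfolding is_subline_def by blast
qed

lemma mem_qpt: "(a, b) \<in> qpt q a (b::'a)"
  unfolding qpt_def using F_1 unfolding F_def by (intro CollectI exI[of _ 1]) simp

lemma qpt_smult:
  fixes a b :: 'a
  assumes "e \<in> F" "e \<noteq> 0"
  shows "qpt q (e * a) (e * b) = qpt q a b"
proof (intro equalityI subsetI)
  fix p assume "p \<in> qpt q (e * a) (e * b)"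
  then obtain c where "c \<in> F" "p = (c * e * a, c * e * b)"
    unfolding qpt_def F_def by (auto simp: mult.assoc)
  then show "p \<in> qpt q a b"
    using F_mult[OF _ assms(1)] unfolding qpt_def F_def by blast
next
  fix p assume "p \<in> qpt q a b"
  then obtain c where c: "c \<in> F" "p = (c * a, c * b)"
    unfolding qpt_def F_def by blast
  then have "p = (c / e * (e * a), c / e * (e * b))"
    using assms(2) by simp
  then show "p \<in> qpt q (e * a) (e * b)"
    using F_divide[OF c(1) assms(1)] unfolding qpt_def F_def by blast
qed

lemma qpt_eqD:
  fixes a b c d :: 'a
  assumes "qpt q a b = qpt q c d"
  obtains e where "e \<in> F" "a = e * c" "b = e * d"
proof -
  have "(a, b) \<in> qpt q c d"
    using assms mem_qpt by metis
  then show thesis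
    using that unfolding qpt_def F_def by blast
qed

text \<open>Passing to \<open>B_set\<close> only enlarges scalars from \<open>F\<close> to the big
  field: representatives of a common point differ by nonzero factors, which \<open>line0_pt\<close>
  ignores.\<close>

lemma B_set_eq:
  fixes g1 g2 :: "'b \<Rightarrow> 'a"
  assumes nz: "\<And>w. w \<in> W \<Longrightarrow> (g1 w, g2 w) \<noteq> (0, 0)"
  shows "B_set q t ((\<lambda>w. qpt q (g1 w) (g2 w)) ` W) = (\<lambda>w. line0_pt t (g1 w) (g2 w)) ` W"
proof (intro equalityI subsetI)
  fix X assume "X \<in> B_set q t ((\<lambda>w. qpt q (g1 w) (g2 w)) ` W)"
  then obtain p where "p \<in> field_red q t X" "p \<in> (\<lambda>w. qpt q (g1 w) (g2 w)) ` W"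
    unfolding B_set_def by blast
  then obtain a b z w where w: "w \<in> W" "qpt q (z * a) (z * b) = qpt q (g1 w) (g2 w)"
    and X: "(a, b) \<noteq> (0, 0)" "X = line0_pt t a b" "z \<noteq> 0"
    unfolding field_red_def by auto
  obtain e where e: "z * a = e * g1 w" "z * b = e * g2 w"
    using qpt_eqD[OF w(2)] by metis
  then have "e \<noteq> 0"
    using X by auto
  have "X = line0_pt t (z * a) (z * b)"
    using line0_pt_smult[OF X(3)] X(2) by simp
  also have "\<dots> = line0_pt t (g1 w) (g2 w)"
    unfolding e by (rule line0_pt_smult[OF \<open>e \<noteq> 0\<close>])
  finally show "X \<in> (\<lambda>w. line0_pt t (g1 w) (g2 w)) ` W"
    using w(1) by blast
next
  fix X assume "X \<in> (\<lambda>w. line0_pt t (g1 w) (g2 w)) ` W"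
  then obtain w where w: "w \<in> W" "X = line0_pt t (g1 w) (g2 w)"
    by blast
  have "qpt q (1 * g1 w) (1 * g2 w) \<in> field_red q t X"
    unfolding field_red_def using w nz[OF w(1)] zero_neq_one[symmetric] by blast
  then have "qpt q (g1 w) (g2 w) \<in> field_red q t X"
    by simp
  then show "X \<in> B_set q t ((\<lambda>w. qpt q (g1 w) (g2 w)) ` W)"
    unfolding B_set_def using w nz[OF w(1)] by blast
qed

lemma span2_nz_iff:
  assumes "indep2 a c"
  shows "span2 a c - {0} = {x * a + y * c | x y. x \<in> F \<and> y \<in> F \<and> (x, y) \<noteq> (0, 0)}"
proof -
  have "x * a + y * c \<noteq> 0 \<longleftrightarrow> (x, y) \<noteq> (0, 0)" if "x \<in> F" "y \<in> F" for x y
    using indep2_comb_eq_0[OF assms that] by simp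
  then have "{x * a + y * c | x y. x \<in> F \<and> y \<in> F \<and> (x, y) \<noteq> (0, 0)} =
      {w. w \<noteq> 0 \<and> (\<exists>x y. w = x * a + y * c \<and> x \<in> F \<and> y \<in> F)}"
    unfolding ex_simps(2)[symmetric] by (intro Collect_cong iff_exI) auto
  then show ?thesis
    unfolding span2_def by auto
qed

lemma B_set_line_in_fam:
  assumes "line_in_fam q t h f" "\<not> t dvd h"
  obtains a c :: 'a where "indep2 a c" "B_set q t f = subline h a c"
proof -
  obtain k where k: "field_norm q t k = 1" and sub: "f \<subseteq> S_sub q h k"
    using assms(1) unfolding line_in_fam_def S_fam_def by blast
  obtain a b c d where nz: "(a, b) \<noteq> (0, 0)" "(c, d) \<noteq> (0, 0)" and ne: "qpt q a b \<noteq> qpt q c d"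
    and f: "f = {qpt q (x * a + y * c) (x * b + y * d) | x y. x \<in> F \<and> y \<in> F \<and> (x, y) \<noteq> (0, 0)}"
    using assms(1) unfolding line_in_fam_def is_qline_def F_def by blast
  \<comment> \<open>The equation of \<open>S_sub\<close> passes to any representative, because
    factors from \<open>F\<close> are fixed by the power \<open>q ^ h\<close>.\<close>
  have inS: "b' = k * a' ^ (q ^ h)" if "qpt q a' b' \<in> f" for a' b'
  proof -
    have "qpt q a' b' \<in> S_sub q h k"
      using that sub by blast
    then obtain z where z: "qpt q a' b' = qpt q z (k * z ^ (q ^ h))"
      unfolding S_sub_def by blast
    from qpt_eqD[OF z] obtain e where e: "e \<in> F" "a' = e * z" "b' = e * (k * z ^ (q ^ h))"
      by blast
    then show ?thesis
      by (simp add: power_mult_distrib F_pow mult_ac)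
  qed
  have "qpt q a b \<in> f"
    unfolding f by (intro CollectI exI[of _ 1] exI[of _ 0]) simp
  moreover have "qpt q c d \<in> f"
    unfolding f by (intro CollectI exI[of _ 0] exI[of _ 1]) simp
  ultimately have b: "b = k * a ^ (q ^ h)" and d: "d = k * c ^ (q ^ h)"
    using inS by blast+
  have c0: "c \<noteq> 0"
    using nz d q1 by (auto simp: power_0_left)
  have a0: "a \<noteq> 0"
    using nz b q1 by (auto simp: power_0_left)
  \<comment> \<open>If \<open>a / c\<close> were in \<open>F\<close>, then \<open>b\<close> would be
    the same multiple of \<open>d\<close>, and the two generating points would coincide.\<close>
  have ac: "indep2 a c"
    unfolding indep2_def
  proof (intro conjI notI)
    assume e: "a / c \<in> F"
    have a: "a = a / c * c"
      using c0 by simp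
    have "b = a / c * d"
    proof -
      have "b = k * (a / c * c) ^ (q ^ h)"
        using a b by simp
      also have "\<dots> = a / c * d"
        unfolding power_mult_distrib F_pow[OF e] d by (simp only: mult_ac)
      finally show ?thesis .
    qed
    then have "qpt q a b = qpt q (a / c * c) (a / c * d)"
      using a by simp
    also have "\<dots> = qpt q c d"
      by (rule qpt_smult[OF e]) (use a0 c0 in simp)
    finally show False
      using ne by simp
  qed (use c0 in simp)
  have comb: "x * b + y * d = k * (x * a + y * c) ^ (q ^ h)" if "x \<in> F" "y \<in> F" for x y
    unfolding comb_pow[OF that] b d by (simp add: algebra_simps)
  have "f = (\<lambda>w. qpt q w (k * w ^ (q ^ h))) ` (span2 a c - {0})"
    unfolding span2_nz_iff[OF ac] f using comb by (auto simp: image_iff; metis)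
  then have B: "B_set q t f = (\<lambda>w. line0_pt t w (k * w ^ (q ^ h))) ` (span2 a c - {0})"
    using B_set_eq[of "span2 a c - {0}" "\<lambda>w. w" "\<lambda>w. k * w ^ (q ^ h)"] by simp
  \<comment> \<open>Multiplication by \<open>m\<close> absorbs \<open>k\<close>: it takes
    \<open>(w, k * w ^ (q ^ h))\<close> to \<open>(m * w, (m * w) ^ (q ^ h))\<close>, the same point
    of the line.\<close>
  obtain m where m: "m \<noteq> 0" "m ^ (q ^ h) = k * m"
    using hilbert_90[OF k assms(2)] .
  have "line0_pt t w (k * w ^ (q ^ h)) = line0_pt t (m * w) ((m * w) ^ (q ^ h))" for w
    using line0_pt_smult[OF m(1), of t w "k * w ^ (q ^ h)"] by (simp add: power_mult_distrib m(2) mult_ac)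
  moreover have "span2 (m * a) (m * c) - {0} = (\<lambda>w. m * w) ` (span2 a c - {0})"
    unfolding span2_mult using m(1) by auto
  ultimately have "B_set q t f = subline h (m * a) (m * c)"
    unfolding B subline_def by (simp add: image_image)
  then show thesis
    using that indep2_mult[OF ac m(1)] by blast
qed

lemma line_in_fam_exists:
  assumes ac: "indep2 a c"
  obtains f where "line_in_fam q t h f" "B_set q t f = subline h a c"
proof -
  define f where "f = (\<lambda>w. qpt q w (w ^ (q ^ h))) ` (span2 a c - {0})"
  have f: "f = {qpt q (x * a + y * c) (x * a ^ (q ^ h) + y * c ^ (q ^ h)) | x y.
      x \<in> F \<and> y \<in> F \<and> (x, y) \<noteq> (0, 0)}"
    unfolding f_def span2_nz_iff[OF ac] using comb_pow[of _ _ a c h] by (auto simp: image_iff; metis)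
  have "qpt q a (a ^ (q ^ h)) \<noteq> qpt q c (c ^ (q ^ h))"
  proof
    assume "qpt q a (a ^ (q ^ h)) = qpt q c (c ^ (q ^ h))"
    from qpt_eqD[OF this] obtain e where "e \<in> F" "a = e * c"
      by blast
    then show False
      using ac by (simp add: indep2_def split: if_splits)
  qed
  moreover have "(a, a ^ (q ^ h)) \<noteq> (0, 0)" "(c, c ^ (q ^ h)) \<noteq> (0, 0)"
    using indep2_nz[OF ac] by simp_all
  ultimately have "is_qline q f"
    unfolding is_qline_def F_def[symmetric] using f by blast
  moreover have "f \<subseteq> S_sub q h 1"
    unfolding f_def S_sub_def by auto
  moreover have "field_norm q t (1::'a) = 1"
    by (simp add: field_norm_def)
  ultimately have "line_in_fam q t h f"
    unfolding line_in_fam_def S_fam_def by blast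
  moreover have "B_set q t f = subline h a c"
    using B_set_eq[of "span2 a c - {0}" "\<lambda>w. w" "\<lambda>w. w ^ (q ^ h)"] by (simp add: f_def subline_def)
  ultimately show thesis
    using that by blast
qed

text \<open>The factor \<open>Q n w / w\<close> takes \<open>(w, (\<sigma> ^^ n) w)\<close> to
  \<open>(Q n w, \<sigma> (Q n w))\<close>, and the congruence identifies
  \<open>\<sigma> ^^ n\<close> with the power \<open>q ^ h\<close>. The generators are shifted by
  \<open>\<sigma> ^^ 2\<close> to suit \<open>proj_V_shift\<close>.\<close>

lemma subline_eq_proj_curve:
  assumes "[\<nu> * n = h] (mod t)"
  shows "subline h a c = proj t ` curve n ((\<sigma> ^^ 2) a) ((\<sigma> ^^ 2) c)"
proof -
  have "proj t (pt (V (Q n ((\<sigma> ^^ 2) w)))) = line0_pt t w (w ^ (q ^ h))" if w: "w \<noteq> 0" for w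
  proof -
    have "(\<sigma> ^^ n) w = w ^ (q ^ h)"
      unfolding sigma_funpow using assms by (rule pow_cong)
    then have "\<sigma> (Q n w) = Q n w / w * w ^ (q ^ h)"
      using sigma_Q[of n w] w by (simp add: field_simps)
    moreover have "Q n w = Q n w / w * w"
      using w by simp
    ultimately have "line0_pt t (Q n w) (\<sigma> (Q n w)) = line0_pt t (Q n w / w * w) (Q n w / w * w ^ (q ^ h))"
      by simp
    also have "\<dots> = line0_pt t w (w ^ (q ^ h))"
      by (rule line0_pt_smult) (use w Q_nz in simp)
    finally show ?thesis
      unfolding Q_s proj_V_shift .
  qed
  moreover have "span2 ((\<sigma> ^^ 2) a) ((\<sigma> ^^ 2) c) - {0} = (\<sigma> ^^ 2) ` (span2 a c - {0})"
    unfolding span2_s by (auto simp del: funpow.simps simp: image_iff)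
  ultimately show ?thesis
    unfolding subline_def curve_def by (simp add: image_image)
qed

lemma sublines_are_projected_nrcs:
  assumes "line_in_fam q t h f" "0 < n" "n < t" "[\<nu> * n = h] (mod t)"
  obtains a c :: 'a where "indep2 a c" "is_subline q t (B_set q t f)"
    "B_set q t f = proj t ` curve n a c" "is_nrc_in q t (subgeom q t \<nu>) n (curve n a c)"
proof -
  have "\<not> t dvd \<nu> * n"
    using not_dvd_less[OF assms(2,3)] not_dvd_nu t_prime by (simp add: prime_dvd_mult_iff)
  then have h: "\<not> t dvd h"
    using cong_dvd_iff[OF assms(4)] by (metis cong_0_iff cong_sym cong_trans assms(4))
  obtain a c where ac: "indep2 a c" "B_set q t f = subline h a c"
    using B_set_line_in_fam[OF assms(1) h] .
  show thesis
    using that[OF indep2_s_s[OF ac(1), of 2]] is_subline_subline[OF ac(1) h] ac(2)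
      subline_eq_proj_curve[OF assms(4), of a c] is_nrc_in_curve[OF indep2_s_s[OF ac(1), of 2] assms(3)]
    by simp
qed

end

subsection \<open>Curves through the coordinate points\<close>

text \<open>For pairwise independent linear forms \<open>L i = x * \<alpha> i + y * \<gamma> i\<close>, the coordinatewise
  inverse of a point of this curve is \<open>L j / d j\<close> up to a scalar, so inversion maps the curve
  to a line.\<close>

definition inverse_line_curve ::
    "nat \<Rightarrow> (nat \<Rightarrow> 'a::field) \<Rightarrow> (nat \<Rightarrow> 'a) \<Rightarrow> (nat \<Rightarrow> 'a) \<Rightarrow> 'a vec set set" where
  "inverse_line_curve m \<alpha> \<gamma> d =
    {pt (vec m (\<lambda>j. d j * (\<Prod>i\<in>{..<m} - {j}. x * \<alpha> i + y * \<gamma> i))) | x y. (x, y) \<noteq> (0, 0)}"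

lemma inverse_line_curve_scale:
  fixes s x y :: "'a::field"
  assumes "s \<noteq> 0"
  shows "pt (vec m (\<lambda>j. d j * (\<Prod>i\<in>{..<m} - {j}. (s * x) * \<alpha> i + (s * y) * \<gamma> i))) =
    pt (vec m (\<lambda>j. d j * (\<Prod>i\<in>{..<m} - {j}. x * \<alpha> i + y * \<gamma> i)))"
proof (rule pt_vec_eqI[of "s ^ (m - 1)"])
  fix j assume "j < m"
  then have "card ({..<m} - {j}) = m - 1"
    by simp
  moreover have "(s * x) * \<alpha> i + (s * y) * \<gamma> i = s * (x * \<alpha> i + y * \<gamma> i)" for i
    by (simp add: algebra_simps)
  ultimately show "d j * (\<Prod>i\<in>{..<m} - {j}. (s * x) * \<alpha> i + (s * y) * \<gamma> i) =
      s ^ (m - 1) * (d j * (\<Prod>i\<in>{..<m} - {j}. x * \<alpha> i + y * \<gamma> i))"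
    by (simp add: prod.distrib mult_ac)
qed (use assms in simp)

text \<open>The homogeneous parameter \<open>(x, y)\<close> is split into \<open>(1, y)\<close> and
  \<open>(0, 1)\<close> to match the shape of \<open>mat_image_std_nrc\<close>.\<close>

lemma inverse_line_curve_affine:
  fixes \<alpha> \<gamma> d :: "nat \<Rightarrow> 'a::field"
  shows "inverse_line_curve m \<alpha> \<gamma> d =
    {pt (vec m (\<lambda>j. d j * (\<Prod>i\<in>{..<m} - {j}. \<alpha> i + y * \<gamma> i))) | y. y \<in> UNIV} \<union>
    {pt (vec m (\<lambda>j. d j * (\<Prod>i\<in>{..<m} - {j}. \<gamma> i)))}"
    (is "_ = {?P y | y. y \<in> UNIV} \<union> {?Q}")
proof (intro equalityI subsetI)
  fix P assume "P \<in> inverse_line_curve m \<alpha> \<gamma> d"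
  then obtain x y where xy: "(x, y) \<noteq> (0, 0)"
    and P: "P = pt (vec m (\<lambda>j. d j * (\<Prod>i\<in>{..<m} - {j}. x * \<alpha> i + y * \<gamma> i)))"
    unfolding inverse_line_curve_def by blast
  show "P \<in> {?P y | y. y \<in> UNIV} \<union> {?Q}"
  proof (cases "x = 0")
    case True
    then have "y \<noteq> 0"
      using xy by simp
    from inverse_line_curve_scale[OF this, of m d 0 \<alpha> 1 \<gamma>] have "P = ?Q"
      unfolding P using True by simp
    then show ?thesis
      by blast
  next
    case False
    from inverse_line_curve_scale[OF this, of m d 1 \<alpha> "y / x" \<gamma>] have "P = ?P (y / x)"
      unfolding P using False by simp
    then show ?thesis
      by blast
  qed
next
  fix P assume "P \<in> {?P y | y. y \<in> UNIV} \<union> {?Q}"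
  then consider y where "P = ?P y" | "P = ?Q"
    by blast
  then show "P \<in> inverse_line_curve m \<alpha> \<gamma> d"
  proof cases
    case 1
    then show ?thesis
      unfolding inverse_line_curve_def by (intro CollectI exI[of _ 1] exI[of _ y]) simp
  next
    case 2
    then show ?thesis
      unfolding inverse_line_curve_def by (intro CollectI exI[of _ 0] exI[of _ 1]) simp
  qed
qed

text \<open>Inversion makes sense off the coordinate hyperplanes, where all points of
  \<open>\<Sigma>\<close> lie. There coordinate \<open>j\<close> is \<open>d j * T / L j\<close> up
  to a factor, with \<open>T\<close> the product of all forms.\<close>

lemma mem_inverse_line_curve:
  fixes \<alpha> \<gamma> d v :: "nat \<Rightarrow> 'a::field"
  assumes m: "2 \<le> m" and d: "\<And>j. j < m \<Longrightarrow> d j \<noteq> 0" and v: "\<And>j. j < m \<Longrightarrow> v j \<noteq> 0"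
  shows "pt (vec m v) \<in> inverse_line_curve m \<alpha> \<gamma> d \<longleftrightarrow>
    (\<exists>x y. \<forall>j<m. d j * inverse (v j) = x * \<alpha> j + y * \<gamma> j)"
proof
  assume "pt (vec m v) \<in> inverse_line_curve m \<alpha> \<gamma> d"
  then obtain x y where
    eq: "pt (vec m v) = pt (vec m (\<lambda>j. d j * (\<Prod>i\<in>{..<m} - {j}. x * \<alpha> i + y * \<gamma> i)))"
    unfolding inverse_line_curve_def by blast
  obtain s where s: "s \<noteq> 0" "\<And>j. j < m \<Longrightarrow> v j = s * (d j * (\<Prod>i\<in>{..<m} - {j}. x * \<alpha> i + y * \<gamma> i))"
    using pt_vec_eqD[OF eq, of 0] v[of 0] m by auto
  define L where "L i = x * \<alpha> i + y * \<gamma> i" for i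
  define T where "T = (\<Prod>i<m. L i)"
  \<comment> \<open>The form \<open>L i\<close> is a factor of coordinate \<open>j\<close> for each
    \<open>j\<close> other than \<open>i\<close>; such a \<open>j\<close> exists as
    \<open>2 \<le> m\<close>.\<close>
  have Lnz: "L i \<noteq> 0" if i: "i < m" for i
  proof -
    obtain j where j: "j < m" "j \<noteq> i"
      using m i by (metis One_nat_def Suc_1 Suc_le_lessD lessI less_trans neq0_conv zero_neq_one)
    then have "(\<Prod>i\<in>{..<m} - {j}. L i) \<noteq> 0"
      using s(2)[OF j(1)] v[OF j(1)] by (auto simp: L_def)
    then show ?thesis
      using i j by auto
  qed
  have T: "T = L j * (\<Prod>i\<in>{..<m} - {j}. L i)" if "j < m" for j
    unfolding T_def using that by (intro prod.remove) auto
  have Tnz: "T \<noteq> 0"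
    unfolding T_def using Lnz by simp
  have "d j * inverse (v j) = x / (s * T) * \<alpha> j + y / (s * T) * \<gamma> j" if j: "j < m" for j
  proof -
    have "v j * L j = s * d j * T"
      using s(2)[OF j] T[OF j] by (simp add: L_def mult_ac)
    then have "d j * inverse (v j) = L j / (s * T)"
      using v[OF j] s(1) Tnz by (simp add: field_simps)
    then show ?thesis
      by (simp add: L_def add_divide_distrib)
  qed
  then show "\<exists>x y. \<forall>j<m. d j * inverse (v j) = x * \<alpha> j + y * \<gamma> j"
    by blast
next
  assume "\<exists>x y. \<forall>j<m. d j * inverse (v j) = x * \<alpha> j + y * \<gamma> j"
  then obtain x y where xy: "\<And>j. j < m \<Longrightarrow> d j * inverse (v j) = x * \<alpha> j + y * \<gamma> j"
    by blast
  define L where "L i = x * \<alpha> i + y * \<gamma> i" for i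
  define T where "T = (\<Prod>i<m. L i)"
  have L: "L j = d j * inverse (v j)" if "j < m" for j
    using xy[OF that] by (simp add: L_def)
  have Lnz: "L j \<noteq> 0" if "j < m" for j
    using L d v that by simp
  have Tnz: "T \<noteq> 0"
    unfolding T_def using Lnz by simp
  have T: "T = L j * (\<Prod>i\<in>{..<m} - {j}. L i)" if "j < m" for j
    unfolding T_def using that by (intro prod.remove) auto
  have "pt (vec m v) = pt (vec m (\<lambda>j. d j * (\<Prod>i\<in>{..<m} - {j}. L i)))"
  proof (rule pt_vec_eqI[of "inverse T"])
    fix j assume j: "j < m"
    have "T * v j = d j * (\<Prod>i\<in>{..<m} - {j}. L i)"
      unfolding T[OF j] L[OF j] using v[OF j] by simp
    then show "v j = inverse T * (d j * (\<Prod>i\<in>{..<m} - {j}. L i))"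
      using Tnz by (simp add: field_simps)
  qed (use Tnz in simp)
  moreover have "(x, y) \<noteq> (0, 0)"
    using Lnz[of 0] m by (auto simp: L_def)
  ultimately show "pt (vec m v) \<in> inverse_line_curve m \<alpha> \<gamma> d"
    unfolding inverse_line_curve_def L_def by blast
qed

text \<open>Both sides agree at \<open>card S\<close> distinct points and in the coefficient at
  \<open>card S\<close>, which may be 0.\<close>

lemma poly_eq_smult_prod_roots:
  fixes p :: "'a::field poly"
  assumes "finite S" "inj_on r S" "degree p \<le> card S" "\<And>i. i \<in> S \<Longrightarrow> poly p (r i) = 0"
  shows "p = smult (poly.coeff p (card S)) (\<Prod>i\<in>S. [:- r i, 1:])"
proof (rule poly_eqI_degree_lead_coeff[where A = "r ` S" and n = "card S"])
  note * = prod_linear_degree_coeff[OF assms(1), of "\<lambda>i. - r i" "\<lambda>i. 1"]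
  show "poly.coeff p (card S) =
      poly.coeff (smult (poly.coeff p (card S)) (\<Prod>i\<in>S. [:- r i, 1:])) (card S)"
    using * by simp
  show "degree (smult (poly.coeff p (card S)) (\<Prod>i\<in>S. [:- r i, 1:])) \<le> card S"
    using * degree_smult_le le_trans by blast
  show "card S \<le> card (r ` S)"
    using assms(2) by (simp add: card_image)
  fix z assume "z \<in> r ` S"
  then obtain i where "i \<in> S" "z = r i"
    by blast
  then show "poly p z = poly (smult (poly.coeff p (card S)) (\<Prod>i\<in>S. [:- r i, 1:])) z"
    using assms(1,4) by (auto simp: poly_prod)
qed (fact assms(3))

text \<open>A parameter at infinity is encoded as \<open>None\<close> and contributes the constant linear form;
  this is consistent, since then all rows but one have degree at most \<open>m - 2\<close>.\<close>

lemma nrc_through_unit_points: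
  fixes C :: "'a::field vec set set"
  assumes C: "is_nrc m C" and unit: "\<And>i. i < m \<Longrightarrow> pt (unit_vec m i) \<in> C"
  obtains \<alpha> \<gamma> d where "\<And>i j. i < m \<Longrightarrow> j < m \<Longrightarrow> i \<noteq> j \<Longrightarrow> \<alpha> i * \<gamma> j \<noteq> \<alpha> j * \<gamma> i"
    "\<And>j. j < m \<Longrightarrow> d j \<noteq> 0" "C = inverse_line_curve m \<alpha> \<gamma> d"
proof -
  obtain A where "projectivity_mat m A" and CA: "C = mat_image A (std_nrc UNIV m (m - 1))"
    using C unfolding is_nrc_def by blast
  then have A: "A \<in> carrier_mat m m"
    by (simp add: projectivity_mat_def)
  define g where "g j = (\<Sum>k<m. Polynomial.monom (A $$ (j, k)) k)" for j
  have coeff_g: "poly.coeff (g j) k = (if k < m then A $$ (j, k) else 0)" for j k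
    by (simp add: g_def coeff_sum)
  have deg_g: "degree (g j) \<le> m - 1" for j
    by (rule degree_le) (auto simp: coeff_g)
  have A_mult: "(A *\<^sub>v v) $ j = (\<Sum>k<m. A $$ (j, k) * v $ k)" if "j < m" "v \<in> carrier_vec m" for j v
    using A that by (simp add: scalar_prod_def atLeast0LessThan)
  have Ay: "A *\<^sub>v vec m (\<lambda>i. if i \<le> m - 1 then y ^ i else 0) = vec m (\<lambda>j. poly (g j) y)" for y
  proof (rule eq_vecI)
    fix j assume "j < dim_vec (vec m (\<lambda>j. poly (g j) y))"
    then show "(A *\<^sub>v vec m (\<lambda>i. if i \<le> m - 1 then y ^ i else 0)) $ j = vec m (\<lambda>j. poly (g j) y) $ j"
      by (simp add: A_mult g_def poly_sum poly_monom) (rule sum.cong, auto)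
  qed (use A in simp)
  have Au: "A *\<^sub>v unit_vec m (m - 1) = vec m (\<lambda>j. poly.coeff (g j) (m - 1))"
  proof (rule eq_vecI)
    fix j assume "j < dim_vec (vec m (\<lambda>j. poly.coeff (g j) (m - 1)))"
    then have j: "j < m"
      by simp
    have "(A *\<^sub>v unit_vec m (m - 1)) $ j = (\<Sum>k<m. A $$ (j, k) * (if k = m - 1 then 1 else 0))"
      unfolding A_mult[OF j unit_vec_carrier] by (rule sum.cong) (auto simp: unit_vec_def)
    then show "(A *\<^sub>v unit_vec m (m - 1)) $ j = vec m (\<lambda>j. poly.coeff (g j) (m - 1)) $ j"
      using j by (simp add: coeff_g if_distrib cong: if_cong)
  qed (use A in simp)
  have C_eq: "C = {pt (vec m (\<lambda>j. poly (g j) y)) | y. y \<in> UNIV} \<union>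
      {pt (vec m (\<lambda>j. poly.coeff (g j) (m - 1)))}"
    unfolding CA mat_image_std_nrc[OF A] Ay Au ..
  define ev where "ev p = (\<lambda>j. case p of Some y \<Rightarrow> poly (g j) y | None \<Rightarrow> poly.coeff (g j) (m - 1))" for p
  have "\<exists>p. \<forall>j<m. ev p j = 0 \<longleftrightarrow> j \<noteq> i" if i: "i < m" for i
  proof -
    have "\<exists>p. pt (unit_vec m i) = pt (vec m (ev p))"
    proof -
      consider y where "pt (unit_vec m i) = pt (vec m (\<lambda>j. poly (g j) y))"
        | "pt (unit_vec m i) = pt (vec m (\<lambda>j. poly.coeff (g j) (m - 1)))"
        using unit[OF i] unfolding C_eq by blast
      then show ?thesis
      proof cases
        case 1
        then show ?thesis
          by (intro exI[of _ "Some y"]) (simp add: ev_def)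
      next
        case 2
        then show ?thesis
          by (intro exI[of _ None]) (simp add: ev_def)
      qed
    qed
    then obtain p where p: "pt (unit_vec m i) = pt (vec m (ev p))"
      by blast
    obtain s where "s \<noteq> 0" "\<And>j. j < m \<Longrightarrow> (if j = i then 1 else 0) = s * ev p j"
      using pt_vec_eqD[OF p[unfolded unit_vec_def] i] by auto
    then show ?thesis
      by (metis mult_eq_0_iff zero_neq_one)
  qed
  \<comment> \<open>At the parameter of the \<open>i\<close>-th coordinate point only row
    \<open>i\<close> is nonzero. So row \<open>j\<close> vanishes at the other \<open>m - 1\<close>
    parameters, which determine it up to a scalar.\<close>
  then obtain par where par: "\<And>i j. i < m \<Longrightarrow> j < m \<Longrightarrow> ev (par i) j = 0 \<longleftrightarrow> j \<noteq> i"
    by metis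
  then have par_inj: "i = j" if "par i = par j" "i < m" "j < m" for i j
    using that by metis
  define \<alpha> where "\<alpha> i = (case par i of Some y \<Rightarrow> - y | None \<Rightarrow> 1)" for i
  define \<gamma> :: "nat \<Rightarrow> 'a" where "\<gamma> i = (case par i of Some y \<Rightarrow> 1 | None \<Rightarrow> 0)" for i
  define S where "S j = {i. i < m \<and> i \<noteq> j \<and> par i \<noteq> None}" for j
  \<comment> \<open>The scalar left open by the roots; it is nonzero because row \<open>j\<close>
    does not vanish at its own parameter.\<close>
  define d where "d j = poly.coeff (g j) (card (S j))" for j
  have dist: "\<alpha> i * \<gamma> j \<noteq> \<alpha> j * \<gamma> i" if "i < m" "j < m" "i \<noteq> j" for i j
    using par_inj[of i j] that by (cases "par i"; cases "par j") (auto simp: \<alpha>_def \<gamma>_def)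
  have g_prod: "g j = smult (d j) (\<Prod>i\<in>{..<m} - {j}. [:\<alpha> i, \<gamma> i:])" if j: "j < m" for j
  proof -
    have fin: "finite (S j)"
      by (simp add: S_def)
    have deg: "degree (g j) \<le> card (S j)"
    proof (cases "\<exists>i<m. i \<noteq> j \<and> par i = None")
      case False
      then have "S j = {..<m} - {j}"
        by (auto simp: S_def)
      then show ?thesis
        using deg_g[of j] j by simp
    next
      case True
      then obtain i where i: "i < m" "i \<noteq> j" "par i = None"
        by blast
      have "par k \<noteq> None" if "k < m" "k \<noteq> i" for k
        using par_inj[of k i] i that by auto
      then have "S j = {..<m} - {j, i}"
        using i by (auto simp: S_def simp del: not_None_eq)
      then have "card (S j) = m - 2"
        using i j by (simp add: card_Diff_subset)
      moreover have "poly.coeff (g j) (m - 1) = 0"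
        using par[OF i(1) j] i by (simp add: ev_def)
      then have "degree (g j) \<noteq> m - 1 \<or> g j = 0"
        by (metis leading_coeff_0_iff)
      then have "degree (g j) \<le> m - 2"
        using deg_g[of j] by auto
      ultimately show ?thesis
        by simp
    qed
    have inj: "inj_on (\<lambda>i. the (par i)) (S j)"
      by (rule inj_onI) (auto simp: S_def intro: par_inj)
    have root: "poly (g j) (the (par i)) = 0" if "i \<in> S j" for i
      using that par[of i j] j by (auto simp: S_def ev_def)
    have "g j = smult (d j) (\<Prod>i\<in>S j. [:- the (par i), 1:])"
      unfolding d_def by (rule poly_eq_smult_prod_roots[OF fin inj deg root])
    also have "(\<Prod>i\<in>S j. [:- the (par i), 1:]) = (\<Prod>i\<in>{..<m} - {j}. [:\<alpha> i, \<gamma> i:])"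
      by (rule prod.mono_neutral_cong_left) (auto simp: S_def \<alpha>_def \<gamma>_def one_pCons split: option.splits)
    finally show ?thesis .
  qed
  have d: "d j \<noteq> 0" if j: "j < m" for j
  proof
    assume "d j = 0"
    then have "g j = 0"
      using g_prod[OF j] by simp
    then have "ev (par j) j = 0"
      by (simp add: ev_def split: option.split)
    then show False
      using par[OF j j] by simp
  qed
  have "poly (g j) y = d j * (\<Prod>i\<in>{..<m} - {j}. \<alpha> i + y * \<gamma> i)" if "j < m" for j y
    unfolding g_prod[OF that] by (simp add: poly_prod)
  moreover have "poly.coeff (g j) (m - 1) = d j * (\<Prod>i\<in>{..<m} - {j}. \<gamma> i)" if "j < m" for j
    unfolding g_prod[OF that] using prod_linear_degree_coeff(2)[of "{..<m} - {j}" \<alpha> \<gamma>] that by simp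
  ultimately have "vec m (\<lambda>j. poly (g j) y) = vec m (\<lambda>j. d j * (\<Prod>i\<in>{..<m} - {j}. \<alpha> i + y * \<gamma> i))"
    "vec m (\<lambda>j. poly.coeff (g j) (m - 1)) = vec m (\<lambda>j. d j * (\<Prod>i\<in>{..<m} - {j}. \<gamma> i))" for y
    by (auto intro!: eq_vecI)
  then have "C = inverse_line_curve m \<alpha> \<gamma> d"
    unfolding C_eq inverse_line_curve_affine by simp
  then show thesis
    using that dist d by blast
qed

context field_ext
begin

lemma indep2_det:
  assumes "indep2 a c"
  shows "(\<sigma> ^^ i) a * (\<sigma> ^^ Suc i) c - (\<sigma> ^^ Suc i) a * (\<sigma> ^^ i) c \<noteq> 0"
  using indep2_s[OF assms, of 1 i] not_dvd_less[of 1] t3 by simp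

text \<open>Coordinates \<open>1\<close> and \<open>2\<close> already determine \<open>p\<close> and \<open>r\<close>; applying \<open>\<sigma>\<close> to coordinates \<open>0\<close> and \<open>1\<close>
  shows that \<open>\<sigma> p\<close> and \<open>\<sigma> r\<close> solve the same equations.\<close>

lemma V_relation_imp_span2:
  assumes ac: "indep2 a c"
    and rel: "\<And>j. j < t \<Longrightarrow> (\<sigma> ^^ j) u = p * (\<sigma> ^^ j) a + r * (\<sigma> ^^ j) c"
  shows "u \<in> span2 a c"
proof -
  have 1: "(\<sigma> p - p) * (\<sigma> ^^ Suc j) a + (\<sigma> r - r) * (\<sigma> ^^ Suc j) c = 0" if "j < 2" for j
  proof -
    have "(\<sigma> ^^ Suc j) u = \<sigma> p * (\<sigma> ^^ Suc j) a + \<sigma> r * (\<sigma> ^^ Suc j) c"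
      using arg_cong[OF rel[of j], of \<sigma>] that t3 by (simp add: sigma_add sigma_mult)
    moreover have "(\<sigma> ^^ Suc j) u = p * (\<sigma> ^^ Suc j) a + r * (\<sigma> ^^ Suc j) c"
      using rel[of "Suc j"] that t3 by simp
    moreover have "(\<sigma> p - p) * x + (\<sigma> r - r) * y = (\<sigma> p * x + \<sigma> r * y) - (p * x + r * y)" for x y
      by (simp add: algebra_simps)
    ultimately show ?thesis
      by (simp only: right_minus_eq)
  qed
  define P R a1 a2 c1 c2 where "P = \<sigma> p - p" and "R = \<sigma> r - r"
    and "a1 = (\<sigma> ^^ 1) a" and "a2 = (\<sigma> ^^ Suc 1) a" and "c1 = (\<sigma> ^^ 1) c" and "c2 = (\<sigma> ^^ Suc 1) c"
  have eq: "P * a1 + R * c1 = 0" "P * a2 + R * c2 = 0"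
    using 1[of 0] 1[of 1] by (simp_all add: P_def R_def a1_def a2_def c1_def c2_def)
  have D: "a1 * c2 - a2 * c1 \<noteq> 0"
    unfolding a1_def a2_def c1_def c2_def by (rule indep2_det[OF ac])
  have "P * (a1 * c2 - a2 * c1) = c2 * (P * a1 + R * c1) - c1 * (P * a2 + R * c2)"
    "R * (a1 * c2 - a2 * c1) = a1 * (P * a2 + R * c2) - a2 * (P * a1 + R * c1)"
    by (simp_all add: algebra_simps)
  then have "P = 0" "R = 0"
    using D unfolding eq by simp_all
  then have "p \<in> F" "r \<in> F"
    using fixed_imp_F[of 1] not_dvd_less[of 1] t3 by (simp_all add: P_def R_def)
  moreover have "u = p * a + r * c"
    using rel[of 0] t3 by simp
  ultimately show ?thesis
    using span2I by simp
qed

definition inv_curve :: "'a \<Rightarrow> 'a \<Rightarrow> 'a vec set set" where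
  "inv_curve a c = (\<lambda>u. pt (V (inverse u))) ` (span2 a c - {0})"

text \<open>After inversion and scaling by \<open>d\<close>, the curve becomes the line spanned by
  \<open>\<alpha>\<close> and \<open>\<gamma>\<close>, which \<open>V a\<close> and
  \<open>V c\<close> also span. A further point \<open>V u\<close> of that line is a combination of
  them over the big field, hence over \<open>F\<close> by
  \<open>V_relation_imp_span2\<close>.\<close>

lemma inverse_line_curve_inter_subgeom:
  assumes dist: "\<And>i j. i < t \<Longrightarrow> j < t \<Longrightarrow> i \<noteq> j \<Longrightarrow> \<alpha> i * \<gamma> j \<noteq> \<alpha> j * \<gamma> i"
    and d: "\<And>j. j < t \<Longrightarrow> d j \<noteq> 0" and ac: "indep2 a c"
    and a: "pt (V (inverse a)) \<in> inverse_line_curve t \<alpha> \<gamma> d"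
    and c: "pt (V (inverse c)) \<in> inverse_line_curve t \<alpha> \<gamma> d"
  shows "inverse_line_curve t \<alpha> \<gamma> d \<inter> subgeom q t \<nu> = inv_curve a c"
proof -
  have mem: "pt (V (inverse u)) \<in> inverse_line_curve t \<alpha> \<gamma> d \<longleftrightarrow>
      (\<exists>x y. \<forall>j<t. d j * (\<sigma> ^^ j) u = x * \<alpha> j + y * \<gamma> j)" if "u \<noteq> 0" for u
    unfolding V_def
    using mem_inverse_line_curve[of t d "\<lambda>i. (\<sigma> ^^ i) (inverse u)" \<alpha> \<gamma>] t3 d that by simp
  obtain x1 y1 where 1: "\<And>j. j < t \<Longrightarrow> d j * (\<sigma> ^^ j) a = x1 * \<alpha> j + y1 * \<gamma> j"
    using a mem indep2_nz[OF ac] by blast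
  obtain x2 y2 where 2: "\<And>j. j < t \<Longrightarrow> d j * (\<sigma> ^^ j) c = x2 * \<alpha> j + y2 * \<gamma> j"
    using c mem indep2_nz[OF ac] by blast
  \<comment> \<open>Determinant of the change from \<open>\<alpha>\<close>, \<open>\<gamma>\<close>
    to the two given points; comparing the minors on coordinates 0 and 1 shows it to be
    nonzero.\<close>
  define D where "D = x1 * y2 - x2 * y1"
  have D: "D \<noteq> 0"
  proof
    assume "D = 0"
    have "d 0 * d 1 * (a * \<sigma> c - \<sigma> a * c) =
        (d 0 * (\<sigma> ^^ 0) a) * (d 1 * (\<sigma> ^^ 1) c) - (d 1 * (\<sigma> ^^ 1) a) * (d 0 * (\<sigma> ^^ 0) c)"
      by (simp add: algebra_simps)
    also have "\<dots> = (x1 * \<alpha> 0 + y1 * \<gamma> 0) * (x2 * \<alpha> 1 + y2 * \<gamma> 1) -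
        (x1 * \<alpha> 1 + y1 * \<gamma> 1) * (x2 * \<alpha> 0 + y2 * \<gamma> 0)"
      using 1[of 0] 1[of 1] 2[of 0] 2[of 1] t3 by simp
    also have "\<dots> = (\<alpha> 0 * \<gamma> 1 - \<alpha> 1 * \<gamma> 0) * D"
      by (simp add: D_def algebra_simps)
    finally show False
      using \<open>D = 0\<close> d[of 0] d[of 1] t3 indep2_det[OF ac, of 0] by simp
  qed
  show ?thesis
  proof (intro equalityI subsetI)
    fix P assume P: "P \<in> inverse_line_curve t \<alpha> \<gamma> d \<inter> subgeom q t \<nu>"
    then obtain l where l: "l \<noteq> 0" "P = pt (V l)"
      unfolding subgeom_eq by blast
    define u where "u = inverse l"
    have u: "u \<noteq> 0" "P = pt (V (inverse u))"
      using l by (simp_all add: u_def)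
    obtain x y where xy: "\<And>j. j < t \<Longrightarrow> d j * (\<sigma> ^^ j) u = x * \<alpha> j + y * \<gamma> j"
      using P mem u by blast
    have "u \<in> span2 a c"
    proof (rule V_relation_imp_span2[OF ac])
      fix j assume j: "j < t"
      have "D * (d j * (\<sigma> ^^ j) u) =
          (x * y2 - x2 * y) * (d j * (\<sigma> ^^ j) a) + (x1 * y - x * y1) * (d j * (\<sigma> ^^ j) c)"
        unfolding xy[OF j] 1[OF j] 2[OF j] D_def by (simp add: algebra_simps)
      then have "d j * (D * (\<sigma> ^^ j) u) =
          d j * ((x * y2 - x2 * y) * (\<sigma> ^^ j) a + (x1 * y - x * y1) * (\<sigma> ^^ j) c)"
        by (simp add: algebra_simps)
      then have "D * (\<sigma> ^^ j) u = (x * y2 - x2 * y) * (\<sigma> ^^ j) a + (x1 * y - x * y1) * (\<sigma> ^^ j) c"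
        using d[OF j] by simp
      then have "D * (\<sigma> ^^ j) u / D =
          ((x * y2 - x2 * y) * (\<sigma> ^^ j) a + (x1 * y - x * y1) * (\<sigma> ^^ j) c) / D"
        by simp
      then show "(\<sigma> ^^ j) u = (x * y2 - x2 * y) / D * (\<sigma> ^^ j) a + (x1 * y - x * y1) / D * (\<sigma> ^^ j) c"
        using D by (simp add: add_divide_distrib)
    qed
    then show "P \<in> inv_curve a c"
      using u unfolding inv_curve_def by blast
  next
    fix P assume "P \<in> inv_curve a c"
    then obtain u where u: "u \<in> span2 a c" "u \<noteq> 0" "P = pt (V (inverse u))"
      unfolding inv_curve_def by blast
    then obtain p r where pr: "p \<in> F" "r \<in> F" "u = p * a + r * c"
      unfolding span2_def by blast
    have "d j * (\<sigma> ^^ j) u = (p * x1 + r * x2) * \<alpha> j + (p * y1 + r * y2) * \<gamma> j" if j: "j < t" for j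
    proof -
      have "d j * (\<sigma> ^^ j) u = p * (d j * (\<sigma> ^^ j) a) + r * (d j * (\<sigma> ^^ j) c)"
        using pr by (simp add: s_F algebra_simps)
      also have "\<dots> = (p * x1 + r * x2) * \<alpha> j + (p * y1 + r * y2) * \<gamma> j"
        unfolding 1[OF j] 2[OF j] by (simp add: algebra_simps)
      finally show ?thesis .
    qed
    then have "P \<in> inverse_line_curve t \<alpha> \<gamma> d"
      using mem[OF u(2)] u(3) by blast
    moreover have "P \<in> subgeom q t \<nu>"
      using u(2,3) nonzero_imp_inverse_nonzero unfolding subgeom_eq by blast
    ultimately show "P \<in> inverse_line_curve t \<alpha> \<gamma> d \<inter> subgeom q t \<nu>"
      by blast
  qed
qed

text \<open>The \<open>t - 1\<close> consecutive indices after \<open>i\<close> meet every residue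
  except that of \<open>i\<close>, so a window of conjugates is a product omitting one.\<close>

lemma prod_shift_mod:
  fixes f :: "nat \<Rightarrow> 'b::comm_monoid_mult"
  assumes i: "i < t" and f: "\<And>k. f (k mod t) = f k"
  shows "(\<Prod>k<t - 1. f (i + k + 1)) = (\<Prod>k\<in>{..<t} - {i}. f k)"
proof -
  have inj: "inj_on (\<lambda>k. (i + k + 1) mod t) {..<t - 1}"
  proof (rule inj_onI)
    fix k l assume kl: "k \<in> {..<t - 1}" "l \<in> {..<t - 1}" "(i + k + 1) mod t = (i + l + 1) mod t"
    then have "[i + 1 + k = i + 1 + l] (mod t)"
      by (simp add: cong_def ac_simps)
    then have "[k = l] (mod t)"
      by (simp only: cong_add_lcancel_nat)
    then show "k = l"
      using kl by (simp add: cong_def)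
  qed
  have "(\<lambda>k. (i + k + 1) mod t) ` {..<t - 1} = {..<t} - {i}"
  proof (rule card_subset_eq)
    show "(\<lambda>k. (i + k + 1) mod t) ` {..<t - 1} \<subseteq> {..<t} - {i}"
    proof (rule image_subsetI)
      fix k assume k: "k \<in> {..<t - 1}"
      have "(i + k + 1) mod t \<noteq> i"
      proof
        assume "(i + k + 1) mod t = i"
        then have "[i + (k + 1) = i + 0] (mod t)"
          using i by (simp add: cong_def ac_simps)
        then have "[k + 1 = 0] (mod t)"
          by (simp only: cong_add_lcancel_nat)
        then show False
          using k by (simp add: cong_def)
      qed
      then show "(i + k + 1) mod t \<in> {..<t} - {i}"
        using t3 by simp
    qed
    show "card ((\<lambda>k. (i + k + 1) mod t) ` {..<t - 1}) = card ({..<t} - {i})"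
      unfolding card_image[OF inj] using i by simp
  qed simp
  then have "(\<Prod>k\<in>{..<t} - {i}. f k) = (\<Prod>k<t - 1. f ((i + k + 1) mod t))"
    using prod.reindex[OF inj, of f] by (simp add: o_def)
  then show ?thesis
    by (simp only: f)
qed

text \<open>The converse construction: the forms are the conjugates of \<open>x * a + y * c\<close>,
  with all scalars 1. That the curve is normal rational follows from the matrix for order
  \<open>t - 1\<close>, evaluated at all parameters of the big field.\<close>

lemma nrc_through_unit_points_exists:
  assumes ac: "indep2 a c"
  defines "C \<equiv> inverse_line_curve t (\<lambda>i. (\<sigma> ^^ i) a) (\<lambda>i. (\<sigma> ^^ i) c) (\<lambda>_. 1)"
  shows "is_nrc t C" "i < t \<Longrightarrow> pt (unit_vec t i) \<in> C"
    "C \<inter> subgeom q t \<nu> = inv_curve a c"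
    "pt (V (inverse a)) \<in> C" "pt (V (inverse c)) \<in> C"
proof -
  have dist: "(\<sigma> ^^ i) a * (\<sigma> ^^ j) c \<noteq> (\<sigma> ^^ j) a * (\<sigma> ^^ i) c" if "i < t" "j < t" "i \<noteq> j" for i j
  proof -
    show ?thesis
    proof (cases "i < j")
      case True
      then show ?thesis
        using indep2_s[OF ac not_dvd_less[of "j - i"], of i] that by simp
    next
      case False
      then have "(\<sigma> ^^ j) a * (\<sigma> ^^ i) c \<noteq> (\<sigma> ^^ i) a * (\<sigma> ^^ j) c"
        using indep2_s[OF ac not_dvd_less[of "i - j"], of j] that by simp
      then show ?thesis
        by metis
    qed
  qed
  have mem: "pt (V (inverse u)) \<in> C" if "u \<noteq> 0" "\<And>j. (\<sigma> ^^ j) u = x * (\<sigma> ^^ j) a + y * (\<sigma> ^^ j) c" for u x y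
  proof -
    have "\<forall>j<t. 1 * inverse ((\<sigma> ^^ j) (inverse u)) = x * (\<sigma> ^^ j) a + y * (\<sigma> ^^ j) c"
      unfolding that(2)[symmetric] by simp
    then show ?thesis
      unfolding V_def C_def by (subst mem_inverse_line_curve) (use t3 that(1) in auto)
  qed
  show a: "pt (V (inverse a)) \<in> C" and c: "pt (V (inverse c)) \<in> C"
    using mem[of a 1 0] mem[of c 0 1] indep2_nz[OF ac] by simp_all
  show "C \<inter> subgeom q t \<nu> = inv_curve a c"
    using a c unfolding C_def by (intro inverse_line_curve_inter_subgeom dist ac) simp_all
  show "pt (unit_vec t i) \<in> C" if i: "i < t"
  proof -
    \<comment> \<open>The parameter is chosen as the zero of form \<open>i\<close>; it kills every
      coordinate but the \<open>i\<close>-th.\<close>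
    define L where "L k = (\<sigma> ^^ i) c * (\<sigma> ^^ k) a + (- (\<sigma> ^^ i) a) * (\<sigma> ^^ k) c" for k
    have L: "L k = 0 \<longleftrightarrow> k = i" if "k < t" for k
      using dist[OF that i] by (auto simp: L_def algebra_simps)
    define s where "s = (\<Prod>k\<in>{..<t} - {i}. L k)"
    have s: "s \<noteq> 0"
      using L by (simp add: s_def)
    have "pt (vec t (\<lambda>j. 1 * (\<Prod>k\<in>{..<t} - {j}. L k))) = pt (unit_vec t i)"
      unfolding unit_vec_def
    proof (rule pt_vec_eqI[OF s])
      fix j assume "j < t"
      show "1 * (\<Prod>k\<in>{..<t} - {j}. L k) = s * (if j = i then 1 else 0)"
        using L[OF i] i by (auto simp: s_def intro: prod_zero)
    qed
    moreover have "((\<sigma> ^^ i) c, - (\<sigma> ^^ i) a) \<noteq> (0, 0)"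
      using indep2_nz[OF ac] by simp
    ultimately show ?thesis
      unfolding C_def inverse_line_curve_def L_def by blast
  qed
  have "t - 1 < t"
    using t3 by simp
  \<comment> \<open>Starting from \<open>\<sigma> a\<close> and \<open>\<sigma> c\<close> makes row
    \<open>i\<close> a window beginning at \<open>i + 1\<close>, which omits exactly the index
    \<open>i\<close>.\<close>
  obtain A where A: "projectivity_mat t A"
    and "mat_image A (PG_points (Fq q) t) = subgeom q t \<nu>"
    and Ay: "\<forall>y. A *\<^sub>v vec t (\<lambda>j. if j \<le> t - 1 then y ^ j else 0) =
      vec t (\<lambda>i. \<Prod>k<t - 1. (\<sigma> ^^ (i + k)) ((\<sigma> ^^ 1) a) + y * (\<sigma> ^^ (i + k)) ((\<sigma> ^^ 1) c))"
    and Au: "A *\<^sub>v unit_vec t (t - 1) = vec t (\<lambda>i. \<Prod>k<t - 1. (\<sigma> ^^ (i + k)) ((\<sigma> ^^ 1) c))"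
    by (rule nrc_matrix[OF indep2_s_s[OF ac, of 1] \<open>t - 1 < t\<close>])
  have carrier: "A \<in> carrier_mat t t"
    using A by (simp add: projectivity_mat_def)
  have "A *\<^sub>v vec t (\<lambda>j. if j \<le> t - 1 then y ^ j else 0) =
      vec t (\<lambda>i. 1 * (\<Prod>k\<in>{..<t} - {i}. (\<sigma> ^^ k) a + y * (\<sigma> ^^ k) c))" for y
    unfolding Ay[rule_format] s_s
    using prod_shift_mod[of _ "\<lambda>k. (\<sigma> ^^ k) a + y * (\<sigma> ^^ k) c"] by (intro eq_vecI) (simp_all add: s_mod)
  moreover have "A *\<^sub>v unit_vec t (t - 1) = vec t (\<lambda>i. 1 * (\<Prod>k\<in>{..<t} - {i}. (\<sigma> ^^ k) c))"
    unfolding Au s_s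
    using prod_shift_mod[of _ "\<lambda>k. (\<sigma> ^^ k) c"] by (intro eq_vecI) (simp_all add: s_mod)
  ultimately have "mat_image A (std_nrc UNIV t (t - 1)) = C"
    unfolding mat_image_std_nrc[OF carrier] C_def inverse_line_curve_affine by simp
  then show "is_nrc t C"
    unfolding is_nrc_def using A by blast
qed

section \<open>Matching the curves of order \<open>t - 1\<close> with preimages of sublines\<close>

lemma pt_V_inverse_neq:
  assumes "indep2 a c"
  shows "pt (V (inverse a)) \<noteq> pt (V (inverse c))"
proof
  assume "pt (V (inverse a)) = pt (V (inverse c))"
  then obtain x where x: "x \<in> F" "x \<noteq> 0" "inverse a = x * inverse c"
    using pt_V_eqD indep2_nz[OF assms] nonzero_imp_inverse_nonzero by metis
  then have "a / c = 1 / x"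
    using indep2_nz[OF assms] by (simp add: field_simps)
  then show False
    using assms F_divide[OF F_1 x(1)] by (simp add: indep2_def)
qed

lemma indep2I_pt_neq:
  assumes "a \<noteq> 0" "c \<noteq> 0" "pt (V (inverse a)) \<noteq> pt (V (inverse c))"
  shows "indep2 a c"
  unfolding indep2_def
proof (intro conjI notI)
  assume "a / c \<in> F"
  then have "1 / (a / c) \<in> F"
    by (rule F_divide[OF F_1])
  then have "c / a \<in> F"
    by simp
  moreover have "inverse a = c / a * inverse c"
    using assms by (simp add: field_simps)
  ultimately show False
    using assms pt_V_smult[of "c / a" "inverse c"] by simp
qed (use assms in simp)

text \<open>\<open>Q t w\<close> is the product of all conjugates; \<open>sigma_Q\<close> at
  \<open>n = t\<close> shows that it is fixed by \<open>\<sigma>\<close>, and its last factor is the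
  conjugate that gets inverted.\<close>

lemma curve_eq_inv_curve:
  "curve (t - 1) a c = inv_curve ((\<sigma> ^^ (t - 1)) a) ((\<sigma> ^^ (t - 1)) c)"
proof -
  have "pt (V (Q (t - 1) w)) = pt (V (inverse ((\<sigma> ^^ (t - 1)) w)))" if w: "w \<noteq> 0" for w
  proof -
    have "Suc (t - 1) = t"
      using t3 by simp
    then have Qt: "Q t w = Q (t - 1) w * (\<sigma> ^^ (t - 1)) w"
      unfolding Q_def by (metis prod.lessThan_Suc)
    have "\<sigma> (Q t w) = Q t w"
      using sigma_Q[of t w] w by simp
    then have "Q t w \<in> F"
      using fixed_imp_F[of 1] not_dvd_less[of 1] t3 by simp
    moreover have "Q (t - 1) w = Q t w * inverse ((\<sigma> ^^ (t - 1)) w)"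
      using w by (simp add: Qt)
    ultimately show ?thesis
      using pt_V_smult Q_nz[OF w] by metis
  qed
  moreover have "span2 ((\<sigma> ^^ (t - 1)) a) ((\<sigma> ^^ (t - 1)) c) - {0} = (\<sigma> ^^ (t - 1)) ` (span2 a c - {0})"
    unfolding span2_s by auto
  ultimately show ?thesis
    unfolding curve_def inv_curve_def by (simp add: image_image)
qed

lemma sigma_inj: "\<sigma> x = \<sigma> y \<Longrightarrow> x = y"
  using s_diff[of 1 x y] s_eq_0_iff[of 1 "x - y"] by simp

lemma shat_unit: "Suc i < t \<Longrightarrow> shat q t \<nu> (pt (unit_vec t i)) = (pt (unit_vec t (Suc i)) :: 'a vec set)"
proof -
  assume i: "Suc i < t"
  have eq: "vec t (\<lambda>j. frob q \<nu> ((e \<cdot>\<^sub>v unit_vec t i) $ (if j = 0 then t - 1 else j - 1))) =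
      \<sigma> e \<cdot>\<^sub>v unit_vec t (Suc i)" for e :: 'a
    unfolding sigma_def[symmetric] using i s_0[of 1] by (intro eq_vecI) (auto simp: unit_vec_def)
  \<comment> \<open>Surjectivity is needed because the image must contain all multiples of the next
    unit vector.\<close>
  have "surj \<sigma>"
    using sigma_inj by (intro finite_UNIV_inj_surj) (auto intro: injI)
  then have "\<exists>e'. e = \<sigma> e'" for e
    by (metis surjD)
  then show ?thesis
    unfolding shat_def pt_def setcompr_eq_image image_image eq by (auto simp: image_iff; metis)
qed

lemma shat_funpow_P_Gam: "i < t \<Longrightarrow> (shat q t \<nu> ^^ i) (P_Gam t) = (pt (unit_vec t i) :: 'a vec set)"
  by (induction i) (simp_all add: P_Gam_def shat_unit)

lemma preim_eq:
  assumes "B_set q t f = proj t ` C" "C \<subseteq> subgeom q t \<nu>"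
  shows "preim q t \<nu> f = (C :: 'a vec set set)"
  unfolding preim_def assms(1) using inj_onD[OF inj_on_proj] assms(2) by blast

lemma curve_subset: "indep2 a c \<Longrightarrow> curve n a c \<subseteq> subgeom q t \<nu>"
  unfolding curve_def subgeom_eq using Q_nz by blast

text \<open>The order \<open>t - 1\<close> is \<open>-1\<close> modulo \<open>t\<close>, so the
  matching \<open>h\<close> is \<open>-\<nu>\<close>; reducing \<open>\<nu>\<close> first keeps the
  natural subtraction exact for large \<open>\<nu>\<close>.\<close>

lemma cong_minus_nu: "[\<nu> * (t - 1) = t - \<nu> mod t] (mod t)"
proof -
  have "\<nu> * (t - 1) + \<nu> = \<nu> * t"
    using t3 by (cases t) auto
  moreover have "t - \<nu> mod t + \<nu> = t * (\<nu> div t) + t"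
  proof -
    have "\<nu> mod t < t"
      using t3 by simp
    moreover have "t * (\<nu> div t) + \<nu> mod t = \<nu>"
      by simp
    ultimately show ?thesis
      by linarith
  qed
  ultimately have "[\<nu> * (t - 1) + \<nu> = t - \<nu> mod t + \<nu>] (mod t)"
    by (simp add: cong_def)
  then show ?thesis
    by (simp only: cong_add_rcancel_nat)
qed

lemma preim_line_in_fam:
  assumes "line_in_fam q t (t - \<nu> mod t) f"
  obtains a c :: 'a where "indep2 a c" "preim q t \<nu> f = inv_curve a c"
    "is_nrc_in q t (subgeom q t \<nu>) (t - 1) (preim q t \<nu> f)"
proof -
  have "0 < t - 1" "t - 1 < t"
    using t3 by auto
  from sublines_are_projected_nrcs[OF assms this cong_minus_nu]
  obtain a c :: 'a where ac: "indep2 a c" "B_set q t f = proj t ` curve (t - 1) a c"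
    "is_nrc_in q t (subgeom q t \<nu>) (t - 1) (curve (t - 1) a c)"
    by metis
  show thesis
    using that[OF indep2_s_s[OF ac(1), of "t - 1"]] preim_eq[OF ac(2) curve_subset[OF ac(1)]] ac(3)
    by (simp only: curve_eq_inv_curve)
qed

lemma inv_curve_is_preim:
  assumes "indep2 a c"
  obtains f where "line_in_fam q t (t - \<nu> mod t) f" "preim q t \<nu> f = inv_curve a c"
proof -
  let ?a = "(\<sigma> ^^ (t - 1)) a" and ?c = "(\<sigma> ^^ (t - 1)) c"
  \<comment> \<open>The projection contributes exponent 2 and \<open>curve_eq_inv_curve\<close>
    contributes \<open>-1\<close>; generators moved beforehand by \<open>-1\<close> bring the total
    to 0 modulo \<open>t\<close>.\<close>
  have shift: "(\<sigma> ^^ (t - 1)) ((\<sigma> ^^ 2) ((\<sigma> ^^ (t - 1)) x)) = x" for x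
  proof -
    have "t - 1 + (2 + (t - 1)) = t + t"
      using t3 by simp
    then show ?thesis
      unfolding s_s by simp
  qed
  have ac: "indep2 ?a ?c"
    by (rule indep2_s_s[OF assms])
  obtain f where f: "line_in_fam q t (t - \<nu> mod t) f" "B_set q t f = subline (t - \<nu> mod t) ?a ?c"
    by (rule line_in_fam_exists[OF ac])
  have "preim q t \<nu> f = curve (t - 1) ((\<sigma> ^^ 2) ?a) ((\<sigma> ^^ 2) ?c)"
    by (rule preim_eq[OF _ curve_subset[OF indep2_s_s[OF ac]]])
      (simp only: f(2) subline_eq_proj_curve[OF cong_minus_nu])
  then show thesis
    using that[OF f(1)] unfolding curve_eq_inv_curve shift by blast
qed

end

theorem theorem5p13:
  fixes q t \<nu> :: nat
  assumes "prime t" and "3 \<le> t" and "primepow q" and "t \<le> q"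
    and "card (UNIV :: 'a::finite_field set) = q ^ t"
    and "coprime \<nu> t"
  shows
    "proj t ` subgeom q t \<nu> = (lin_set q t \<nu> :: 'a vec set set) \<and>
     (\<forall>h \<in> {1..t - 1}. \<forall>f :: ('a \<times> 'a) set set. line_in_fam q t h f \<longrightarrow>
        is_subline q t (B_set q t f) \<and>
        (\<exists>n \<in> {1..t - 1}. [int n = int h * modular_inverse (int t) (int \<nu>)] (mod int t) \<and>
           (\<exists>C. is_nrc_in q t (subgeom q t \<nu>) n C \<and> B_set q t f = proj t ` C))) \<and>
     (t < q \<longrightarrow>
        (\<forall>f :: ('a \<times> 'a) set set. line_in_fam q t (t - \<nu> mod t) f \<longrightarrow>
           is_nrc_in q t (subgeom q t \<nu>) (t - 1) (preim q t \<nu> f)) \<and>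
        {preim q t \<nu> f | f :: ('a \<times> 'a) set set. line_in_fam q t (t - \<nu> mod t) f} =
        {C \<inter> subgeom q t \<nu> | C. is_nrc t C \<and>
           (\<exists>P \<in> C \<inter> subgeom q t \<nu>. \<exists>Q \<in> C \<inter> subgeom q t \<nu>. P \<noteq> Q) \<and>
           (\<forall>i \<in> {0..t - 1}. (shat q t \<nu> ^^ i) (P_Gam t) \<in> C)})"
proof (intro conjI impI ballI allI)
  interpret field_ext q t \<nu> "frob q \<nu> :: 'a \<Rightarrow> 'a" "Fq q"
    by unfold_locales (use assms in auto)
  show "proj t ` subgeom q t \<nu> = (lin_set q t \<nu> :: 'a vec set set)"
    by (rule proj_subgeom)
  {
    fix h and f :: "('a \<times> 'a) set set"
    assume h: "h \<in> {1..t - 1}" and f: "line_in_fam q t h f"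
    \<comment> \<open>The residue of \<open>h\<close> over \<open>\<nu>\<close>; it is nonzero
      because \<open>t\<close> does not divide \<open>h\<close>, and so lies in the required
      range.\<close>
    define n where "n = nat (int h * modular_inverse (int t) (int \<nu>) mod int t)"
    have int_n: "int n = int h * modular_inverse (int t) (int \<nu>) mod int t"
      using t3 by (simp add: n_def)
    then have n: "[int n = int h * modular_inverse (int t) (int \<nu>)] (mod int t)"
      by (simp add: cong_def)
    have "[int \<nu> * int n = int \<nu> * (int h * modular_inverse (int t) (int \<nu>))] (mod int t)"
      using n by (rule cong_scalar_left)
    also have "int \<nu> * (int h * modular_inverse (int t) (int \<nu>)) =
        int h * (int \<nu> * modular_inverse (int t) (int \<nu>))"
      by (simp only: mult_ac)
    also have "[int h * (int \<nu> * modular_inverse (int t) (int \<nu>)) = int h * 1] (mod int t)"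
      by (intro cong_scalar_left cong_modular_inverse1)
        (use cop in \<open>simp add: coprime_commute\<close>)
    finally have cong: "[\<nu> * n = h] (mod t)"
      by (simp flip: cong_int_iff)
    have "0 < n"
    proof (rule ccontr)
      assume "\<not> 0 < n"
      then have "t dvd h"
        using cong by (simp add: cong_def dvd_eq_mod_eq_0)
      then show False
        using h t3 by (auto dest: dvd_imp_le)
    qed
    have "n < t"
      using int_n t3 by (metis of_nat_less_iff pos_mod_bound of_nat_0_less_iff zero_less_numeral less_le_trans)
    obtain a c where "indep2 a c" "is_subline q t (B_set q t f)" "B_set q t f = proj t ` curve n a c"
      "is_nrc_in q t (subgeom q t \<nu>) n (curve n a c)"
      by (rule sublines_are_projected_nrcs[OF f \<open>0 < n\<close> \<open>n < t\<close> cong])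
    moreover have "n \<in> {1..t - 1}"
      using \<open>0 < n\<close> \<open>n < t\<close> by auto
    ultimately show "is_subline q t (B_set q t f)"
      "\<exists>n \<in> {1..t - 1}. [int n = int h * modular_inverse (int t) (int \<nu>)] (mod int t) \<and>
           (\<exists>C. is_nrc_in q t (subgeom q t \<nu>) n C \<and> B_set q t f = proj t ` C)"
      using n by blast+
  }
  show "is_nrc_in q t (subgeom q t \<nu>) (t - 1) (preim q t \<nu> f)"
    if "line_in_fam q t (t - \<nu> mod t) f" for f :: "('a \<times> 'a) set set"
    using preim_line_in_fam[OF that] by blast
  show "{preim q t \<nu> f | f :: ('a \<times> 'a) set set. line_in_fam q t (t - \<nu> mod t) f} =
        {C \<inter> subgeom q t \<nu> | C. is_nrc t C \<and>
           (\<exists>P \<in> C \<inter> subgeom q t \<nu>. \<exists>Q \<in> C \<inter> subgeom q t \<nu>. P \<noteq> Q) \<and>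
           (\<forall>i \<in> {0..t - 1}. (shat q t \<nu> ^^ i) (P_Gam t) \<in> C)}" (is "?L = ?R")
  proof (intro equalityI subsetI)
    fix X assume "X \<in> ?L"
    then obtain f :: "('a \<times> 'a) set set" where "line_in_fam q t (t - \<nu> mod t) f" "X = preim q t \<nu> f"
      by blast
    then obtain a c :: 'a where ac: "indep2 a c" and X: "X = inv_curve a c"
      using preim_line_in_fam by metis
    define C where
      "C = inverse_line_curve t (\<lambda>i. (frob q \<nu> ^^ i) a) (\<lambda>i. (frob q \<nu> ^^ i) c) (\<lambda>_. 1)"
    note C = nrc_through_unit_points_exists[OF ac, folded C_def]
    have "pt (V (inverse a)) \<in> subgeom q t \<nu>" "pt (V (inverse c)) \<in> subgeom q t \<nu>"
      using indep2_nz[OF ac] nonzero_imp_inverse_nonzero unfolding subgeom_eq by blast+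
    then have "\<exists>P \<in> C \<inter> subgeom q t \<nu>. \<exists>Q \<in> C \<inter> subgeom q t \<nu>. P \<noteq> Q"
      using C(4,5) pt_V_inverse_neq[OF ac] by blast
    moreover have "\<forall>i \<in> {0..t - 1}. (shat q t \<nu> ^^ i) (P_Gam t) \<in> C"
    proof
      fix i assume "i \<in> {0..t - 1}"
      then have "i < t"
        using t3 by auto
      then show "(shat q t \<nu> ^^ i) (P_Gam t) \<in> C"
        using C(2) shat_funpow_P_Gam by simp
    qed
    ultimately show "X \<in> ?R"
      unfolding X C(3)[symmetric] using C(1) by blast
  next
    fix X assume "X \<in> ?R"
    then obtain C P Q where X: "X = C \<inter> subgeom q t \<nu>" and nrc: "is_nrc t C"
      and PQ: "P \<in> C" "P \<in> subgeom q t \<nu>" "Q \<in> C" "Q \<in> subgeom q t \<nu>" "P \<noteq> Q"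
      and base: "\<forall>i \<in> {0..t - 1}. (shat q t \<nu> ^^ i) (P_Gam t) \<in> C"
      by blast
    have unit: "pt (unit_vec t i) \<in> C" if "i < t" for i
      using bspec[OF base, of i] shat_funpow_P_Gam[OF that] that by auto
    obtain \<alpha> \<gamma> d where dist: "\<And>i j. i < t \<Longrightarrow> j < t \<Longrightarrow> i \<noteq> j \<Longrightarrow> \<alpha> i * \<gamma> j \<noteq> \<alpha> j * \<gamma> i"
      and d: "\<And>j. j < t \<Longrightarrow> d j \<noteq> 0" and C: "C = inverse_line_curve t \<alpha> \<gamma> d"
      using nrc_through_unit_points[OF nrc unit] by metis
    obtain l m where lm: "l \<noteq> 0" "P = pt (V l)" "m \<noteq> 0" "Q = pt (V m)"
      using PQ unfolding subgeom_eq by blast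
    \<comment> \<open>The two given points are inverted in advance because \<open>inv_curve\<close>
      is parametrised by inverses.\<close>
    define a c where "a = inverse l" and "c = inverse m"
    have ac: "a \<noteq> 0" "P = pt (V (inverse a))" "c \<noteq> 0" "Q = pt (V (inverse c))"
      using lm by (simp_all add: a_def c_def)
    have ind: "indep2 a c"
      using indep2I_pt_neq[OF ac(1,3)] ac PQ(5) by simp
    have "X = inv_curve a c"
      unfolding X C
      by (rule inverse_line_curve_inter_subgeom[OF dist d ind]) (use ac PQ C in auto)
    moreover obtain f where "line_in_fam q t (t - \<nu> mod t) f" "preim q t \<nu> f = inv_curve a c"
      using inv_curve_is_preim[OF ind] .
    ultimately show "X \<in> ?L"
      by blast
  qed
qed

end
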